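(* Let $E$ and $F$ be real Banach lattices such that $E^*$ and $F^*$ are lattice isomorphic and at least one of $E^*$, $F^*$ has order continuous norm. Then for every $n\in\mathbb{N}$ and every Banach lattice $G$, the Banach lattices $\mathcal{P}^r(^nE;G^* )$ and $\mathcal{P}^r(^nF;G^* )$ are lattice isomorphic.
   Context: An $n$-homogeneous polynomial $P\colon E\to H$ between Banach lattices is positive if its associated symmetric $n$-linear map is positive (nonnegative on tuples of nonnegative vectors). $\mathcal{P}^r(^nE;H)$ denotes the space of regular $n$-homogeneous polynomials (differences of positive ones); when $H$ is Dedekind complete (e.g. $H=G^*$) it is a Banach lattice with the regular norm $\|P\|_r=\||P|\|$. A lattice isomorphism is a linear bijection that preserves lattice operations (equivalently, it and its inverse are positive). *)

theory Defs
  imports "HOL-Analysis.Analysis"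
begin

class banach_lattice = banach + ordered_real_vector + lattice +
  assumes lattice_norm: "sup x (- x) \<le> sup y (- y) \<Longrightarrow> norm x \<le> norm y"

definition dle :: "('a::banach_lattice \<Rightarrow>\<^sub>L real) \<Rightarrow> ('a \<Rightarrow>\<^sub>L real) \<Rightarrow> bool" where
  "dle f g \<longleftrightarrow> (\<forall>x. 0 \<le> x \<longrightarrow> blinfun_apply f x \<le> blinfun_apply g x)"

definition duals_lattice_isomorphic ::
  "'a::banach_lattice itself \<Rightarrow> 'b::banach_lattice itself \<Rightarrow> bool" where
  "duals_lattice_isomorphic _ _ \<longleftrightarrow>
     (\<exists>T :: ('a \<Rightarrow>\<^sub>L real) \<Rightarrow> ('b \<Rightarrow>\<^sub>L real).
        bij T \<and> linear T \<and> (\<forall>f g. dle f g \<longleftrightarrow> dle (T f) (T g)))"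

definition dual_order_continuous :: "'a::banach_lattice itself \<Rightarrow> bool" where
  "dual_order_continuous _ \<longleftrightarrow>
     (\<forall>D :: ('a \<Rightarrow>\<^sub>L real) set.
        D \<noteq> {} \<and> (\<forall>f\<in>D. \<forall>g\<in>D. \<exists>h\<in>D. dle h f \<and> dle h g)
        \<and> (\<forall>f\<in>D. dle 0 f) \<and> (\<forall>h. (\<forall>f\<in>D. dle h f) \<longrightarrow> dle h 0)
        \<longrightarrow> (\<forall>\<epsilon>>0. \<exists>f\<in>D. norm f < \<epsilon>))"

text \<open>Bounded symmetric n-linear maps E^n \<rightarrow> G*, tuples represented as functions
  nat \<Rightarrow> E of which only the first n entries matter.\<close>

definition sym_nlinear :: "nat \<Rightarrow> ((nat \<Rightarrow> 'e::banach_lattice) \<Rightarrow> ('g::banach_lattice \<Rightarrow>\<^sub>L real)) \<Rightarrow> bool" where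
  "sym_nlinear n A \<longleftrightarrow>
     (\<forall>x y. (\<forall>i<n. x i = y i) \<longrightarrow> A x = A y)
     \<and> (\<forall>x i. i < n \<longrightarrow> linear (\<lambda>v. A (x(i := v))))
     \<and> (\<forall>x \<sigma>. \<sigma> permutes {..<n} \<longrightarrow> A (x \<circ> \<sigma>) = A x)
     \<and> (\<exists>C. \<forall>x. norm (A x) \<le> C * (\<Prod>i<n. norm (x i)))"

definition pos_poly :: "nat \<Rightarrow> ('e::banach_lattice \<Rightarrow> ('g::banach_lattice \<Rightarrow>\<^sub>L real)) \<Rightarrow> bool" where
  "pos_poly n P \<longleftrightarrow>
     (\<exists>A. sym_nlinear n A \<and> P = (\<lambda>x. A (\<lambda>_. x))
          \<and> (\<forall>x. (\<forall>i<n. 0 \<le> x i) \<longrightarrow> dle 0 (A x)))"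

definition reg_poly :: "nat \<Rightarrow> ('e::banach_lattice \<Rightarrow> ('g::banach_lattice \<Rightarrow>\<^sub>L real)) set" where
  "reg_poly n = {P. \<exists>P1 P2. pos_poly n P1 \<and> pos_poly n P2 \<and> P = (\<lambda>x. P1 x - P2 x)}"

definition ple :: "nat \<Rightarrow> ('e::banach_lattice \<Rightarrow> ('g::banach_lattice \<Rightarrow>\<^sub>L real))
                    \<Rightarrow> ('e \<Rightarrow> ('g \<Rightarrow>\<^sub>L real)) \<Rightarrow> bool" where
  "ple n P Q \<longleftrightarrow> pos_poly n (\<lambda>x. Q x - P x)"

definition reg_polys_lattice_isomorphic ::
  "nat \<Rightarrow> 'e::banach_lattice itself \<Rightarrow> 'f::banach_lattice itself \<Rightarrow> 'g::banach_lattice itself \<Rightarrow> bool" where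
  "reg_polys_lattice_isomorphic n _ _ _ \<longleftrightarrow>
     (\<exists>T :: ('e \<Rightarrow> ('g \<Rightarrow>\<^sub>L real)) \<Rightarrow> ('f \<Rightarrow> ('g \<Rightarrow>\<^sub>L real)).
        bij_betw T (reg_poly n) (reg_poly n)
        \<and> (\<forall>P\<in>reg_poly n. \<forall>Q\<in>reg_poly n. \<forall>a b.
              T (\<lambda>x. a *\<^sub>R P x + b *\<^sub>R Q x) = (\<lambda>y. a *\<^sub>R T P y + b *\<^sub>R T Q y))
        \<and> (\<forall>P\<in>reg_poly n. \<forall>Q\<in>reg_poly n. ple n P Q \<longleftrightarrow> ple n (T P) (T Q)))"

end

theory Submission
  imports Defs "HOL-Library.Lattice_Algebras"
begin

text \<open>
  Let \<open>T : E* \<rightarrow> F*\<close> be the lattice isomorphism.  An \<open>n\<close>-linear form is transferred from \<open>E\<close> to \<open>F\<close>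
  by applying \<open>T\<close> to one slot after the other, the remaining arguments being held fixed.  This is
  clearly positive and invertible; what needs proof is that symmetric forms stay symmetric, that is,
  that \<open>T\<close> applied in two different slots commutes.  For a positive bilinear form \<open>b\<close> on \<open>E\<close> and
  \<open>\<phi>, \<psi> \<ge> 0\<close> in \<open>E**\<close> this is Arens regularity, \<open>\<phi>(u \<mapsto> \<psi>(b(u, -))) = \<psi>(v \<mapsto> \<phi>(b(-, v)))\<close>.

  If \<open>\<phi>\<close> and \<open>\<psi>\<close> lie below elements of \<open>E\<close>, the identity holds without any assumption: \<open>\<phi>\<close> can be cut
  into layers, and because disjointness in \<open>E**\<close> and in \<open>E*\<close> is witnessed by elements of \<open>E*\<close> and of \<open>E\<close>
  respectively, each layer is close to an element of \<open>E\<close> in the seminorm \<open>|-|(h)\<close>.  In general one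
  truncates by \<open>x \<in> E\<close>.  Order continuity of the norm of \<open>E*\<close> makes the remainders \<open>(\<phi> - x)\<^sup>+\<close>
  decrease to \<open>0\<close>, and a second use of it makes both iterated expressions small on them.
\<close>

section \<open>Banach lattices and positive operators\<close>

text \<open>For fixed \<open>y \<ge> 0\<close> the map \<open>f \<mapsto> T f y\<close> is a
  positive functional on \<open>E*\<close>, hence an element of the bidual. Applying
  \<open>T\<close> in two slots at \<open>y\<close> and \<open>z\<close> therefore evaluates an
  iterated extension of a bilinear form at two bidual elements; this is how Arens regularity enters.
  Values in \<open>G*\<close> are made scalar by evaluating at \<open>g \<ge> 0\<close> beforehand.

  The obstacle lies in the remainders. One iterated expression is the value of the remainder at a
  fixed element of \<open>E*\<close>; rewriting the other in the same way would presuppose the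
  commutation to be proved, hence the second use of order continuity.

  Order continuity is given for one dual only, but it passes along the isomorphism because positive
  operators are automatically bounded. A polynomial shows only the diagonal of its form, so
  polarization is what makes the transfer well defined on polynomials and lets their order be read
  off the forms.\<close>

instance banach_lattice \<subseteq> lattice_ab_group_add ..

lemma scaleR_nonneg [simp]: "0 \<le> c \<Longrightarrow> 0 \<le> x \<Longrightarrow> 0 \<le> c *\<^sub>R (x::'a::banach_lattice)"
  by (rule scaleR_nonneg_nonneg)

lemma pprt_diff_pprt: "(x::'a::lattice_ab_group_add) = pprt x - pprt (- x)"
  using prts[of x] by (simp add: pprt_neg)

lemma pprt_least: "x \<le> y \<Longrightarrow> 0 \<le> y \<Longrightarrow> pprt x \<le> (y::'a::lattice_ab_group_add)"
  by (simp add: pprt_def)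

lemma pprt_ge: "x \<le> pprt (x::'a::lattice_ab_group_add)"
  by (simp add: pprt_def)

lemma sup_minus_self: "sup x (- x) = pprt x + pprt (- (x::'a::lattice_ab_group_add))"
proof -
  have "pprt x + pprt (-x) = sup (x + pprt (-x)) (pprt (-x))"
    by (simp add: pprt_def add_sup_distrib_right)
  also have "x + pprt (-x) = pprt x"
    using pprt_diff_pprt[of x] by (simp add: algebra_simps)
  also have "sup (pprt x) (pprt (- x)) = sup (sup x (- x)) 0"
    by (simp add: pprt_def sup_assoc sup_left_commute sup_commute)
  also have "\<dots> = sup x (- x)"
  proof -
    have "0 \<le> sup x (- x) + sup x (- x)"
      using add_mono[of x "sup x (-x)" "-x" "sup x (-x)"] by simp
    then show ?thesis
      by (simp add: sup_absorb1)
  qed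
  finally show ?thesis ..
qed

lemma norm_mono_interval:
  fixes x y :: "'a::banach_lattice"
  assumes "x \<le> y" "- x \<le> y"
  shows "norm x \<le> norm y"
proof (rule lattice_norm)
  show "sup x (- x) \<le> sup y (- y)"
    using assms by (meson le_supI le_supI1)
qed

lemma norm_mono_nonneg:
  fixes x y :: "'a::banach_lattice"
  assumes "0 \<le> x" "x \<le> y"
  shows "norm x \<le> norm y"
  using assms by (intro norm_mono_interval) (auto intro: order_trans[of _ 0])

lemma nonneg_sup_minus_self: "0 \<le> sup x (- (x::'a::lattice_ab_group_add))"
  by (simp add: sup_minus_self)

lemma norm_sup_minus_self [simp]: "norm (sup x (- x)) = norm (x::'a::banach_lattice)"
proof -
  have "sup (sup x (- x)) (- sup x (- x)) = sup x (- x)"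
    using nonneg_sup_minus_self[of x] by (simp add: minus_le_self_iff sup_absorb1 del: neg_sup_eq_inf)
  then show ?thesis
    by (intro antisym lattice_norm) auto
qed

lemma norm_pprt_le: "norm (pprt x) \<le> norm (x::'a::banach_lattice)"
proof -
  have "norm (pprt x) \<le> norm (sup x (- x))"
    by (rule norm_mono_nonneg) (auto simp: pprt_def nonneg_sup_minus_self)
  then show ?thesis by simp
qed

text \<open>Since \<open>f n \<ge> 0\<close>, the positive part of \<open>- l\<close> lies below
  that of \<open>f n - l\<close>, whose norm tends to 0.\<close>

lemma LIMSEQ_nonneg:
  fixes f :: "nat \<Rightarrow> 'a::banach_lattice"
  assumes "f \<longlonglongrightarrow> l" "\<And>n. 0 \<le> f n"
  shows "0 \<le> l"
proof -
  have "norm (pprt (- l)) \<le> norm (f n - l)" for n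
  proof -
    have "pprt (- l) \<le> pprt (f n - l)"
      using assms(2)[of n] by (intro pprt_mono) simp
    then have "norm (pprt (- l)) \<le> norm (pprt (f n - l))"
      by (intro norm_mono_nonneg) auto
    then show ?thesis
      using norm_pprt_le order_trans by blast
  qed
  moreover have "(\<lambda>n. norm (f n - l)) \<longlonglongrightarrow> 0"
    using assms(1) by (simp add: LIM_zero_iff tendsto_norm_zero)
  ultimately have "norm (pprt (- l)) \<le> 0"
    by (intro LIMSEQ_le_const[where a = "norm (pprt (- l))"]) auto
  then have "pprt (- l) = 0" by simp
  then show ?thesis
    by (simp add: le_zero_iff_zero_pprt[symmetric])
qed

lemma nonneg_le_suminf:
  fixes f :: "nat \<Rightarrow> 'a::banach_lattice"
  assumes "summable f" "\<And>n. 0 \<le> f n"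
  shows "f k \<le> suminf f"
proof -
  have "(\<lambda>n. (\<Sum>i<n + Suc k. f i) - f k) \<longlonglongrightarrow> suminf f - f k"
    by (intro tendsto_diff tendsto_const LIMSEQ_ignore_initial_segment summable_LIMSEQ assms)
  moreover have "0 \<le> (\<Sum>i<n + Suc k. f i) - f k" for n
  proof -
    have "(\<Sum>i<n + Suc k. f i) = f k + (\<Sum>i\<in>{..<n + Suc k} - {k}. f i)"
      by (rule sum.remove) auto
    then show ?thesis
      by (simp add: sum_nonneg assms)
  qed
  ultimately have "0 \<le> suminf f - f k"
    by (rule LIMSEQ_nonneg)
  then show ?thesis by simp
qed

section \<open>Automatic continuity and extension from the positive cone\<close>

lemma positive_linear_mono:
  fixes f :: "'a::banach_lattice \<Rightarrow> 'b::banach_lattice"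
  assumes "linear f" "\<And>x. 0 \<le> x \<Longrightarrow> 0 \<le> f x" "x \<le> y"
  shows "f x \<le> f y"
  using assms(2)[of "y - x"] assms(3) by (simp add: linear_diff[OF assms(1)])

text \<open>If no bound held on the cone, rescaled vectors \<open>z n\<close> of norm
  \<open>(1/2) ^ n\<close> would have images of norm at least \<open>2 ^ n\<close>. By completeness
  all these images lie below the image of the single vector \<open>suminf z\<close>.\<close>

lemma positive_linear_bounded:
  fixes f :: "'a::banach_lattice \<Rightarrow> 'b::banach_lattice"
  assumes lin: "linear f" and pos: "\<And>x. 0 \<le> x \<Longrightarrow> 0 \<le> f x"
  shows "bounded_linear f"
proof -
  have "\<exists>K. \<forall>x\<ge>0. norm (f x) \<le> K * norm x"
  proof (rule ccontr)
    assume "\<nexists>K. \<forall>x\<ge>0. norm (f x) \<le> K * norm x"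
    then have "\<forall>n. \<exists>x\<ge>0. norm (f x) > 4 ^ n * norm x"
      by (meson linorder_not_le)
    then obtain x where x: "\<And>n. 0 \<le> x n" "\<And>n. norm (f (x n)) > 4 ^ n * norm (x n)"
      by metis
    have x0: "norm (x n) > 0" for n
      using x(2)[of n] linear_0[OF lin] by (cases "x n = 0") auto
    \<comment> \<open>The rate \<open>4 ^ n\<close> leaves a factor \<open>2 ^ n\<close> after the
      rescaling that makes the series converge.\<close>
    define z where "z n = (1 / (2 ^ n * norm (x n))) *\<^sub>R x n" for n
    have z0: "0 \<le> z n" for n
      using x x0 by (simp add: z_def)
    have nz: "norm (z n) = (1/2) ^ n" for n
      using x0[of n] by (auto simp: z_def power_divide)
    have "summable z"
      by (rule summable_norm_cancel) (simp add: nz)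
    have "2 ^ n \<le> norm (f (suminf z))" for n
    proof -
      have "(2::real) ^ n = 4 ^ n * norm (x n) * (1 / (2 ^ n * norm (x n)))"
        using x0[of n] by (simp add: field_simps flip: power_mult_distrib)
      also have "\<dots> \<le> norm (f (x n)) * (1 / (2 ^ n * norm (x n)))"
        using x(2)[of n] x0[of n] by (intro mult_right_mono) auto
      also have "\<dots> = norm (f (z n))"
        using x0[of n] by (simp add: z_def linear_scale[OF lin])
      also have "\<dots> \<le> norm (f (suminf z))"
        using z0 nonneg_le_suminf[OF \<open>summable z\<close> z0]
        by (intro norm_mono_nonneg pos positive_linear_mono[OF lin pos]) auto
      finally show ?thesis .
    qed
    moreover obtain n where "norm (f (suminf z)) < 2 ^ n"
      using real_arch_pow[of 2] by auto
    ultimately show False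
      by (meson linorder_not_le)
  qed
  then obtain K where K: "\<And>x. 0 \<le> x \<Longrightarrow> norm (f x) \<le> K * norm x" by auto
  show ?thesis
  proof (rule bounded_linear_intro[where K = "2 * \<bar>K\<bar>"])
    show "f (x + y) = f x + f y" for x y by (rule linear_add[OF lin])
    show "f (r *\<^sub>R x) = r *\<^sub>R f x" for r x by (rule linear_scale[OF lin])
    show "norm (f x) \<le> norm x * (2 * \<bar>K\<bar>)" for x
    proof -
      have *: "norm (f (pprt y)) \<le> \<bar>K\<bar> * norm y" for y
      proof -
        have "norm (f (pprt y)) \<le> K * norm (pprt y)" by (rule K) simp
        also have "\<dots> \<le> \<bar>K\<bar> * norm y"
          by (intro mult_mono norm_pprt_le) auto
        finally show ?thesis .
      qed
      have "norm (f x) = norm (f (pprt x) - f (pprt (- x)))"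
        by (metis linear_diff[OF lin] pprt_diff_pprt)
      also have "\<dots> \<le> norm (f (pprt x)) + norm (f (pprt (- x)))"
        by (rule norm_triangle_ineq4)
      also have "\<dots> \<le> \<bar>K\<bar> * norm x + \<bar>K\<bar> * norm x"
        using *[of x] *[of "- x"] by simp
      finally show ?thesis by (simp add: algebra_simps)
    qed
  qed
qed

instance real :: banach_lattice
proof
  show "sup x (- x) \<le> sup y (- y) \<Longrightarrow> norm x \<le> norm y" for x y :: real
    by (auto simp: sup_real_def max_def abs_if split: if_splits)
qed

text \<open>Cauchy's functional equation: the deviation \<open>d\<close> from the linear function is
  additive and vanishes on the integers, so it has period 1. Positivity bounds it on the unit
  interval, and a bounded additive function is 0.\<close>

lemma additive_nonneg_real_linear:
  fixes g :: "real \<Rightarrow> real"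
  assumes add: "\<And>x y. g (x + y) = g x + g y" and pos: "\<And>x. 0 \<le> x \<Longrightarrow> 0 \<le> g x"
  shows "g c = c * g 1"
proof -
  define d where "d c = g c - c * g 1" for c
  have dadd: "d (x + y) = d x + d y" for x y
    by (simp add: d_def add algebra_simps)
  have d0: "d 0 = 0" using dadd[of 0 0] by simp
  have dn: "d (real n * x) = real n * d x" for n x
    by (induction n) (auto simp: d0 dadd algebra_simps)
  have dm: "d (- x) = - d x" for x
    using dadd[of x "- x"] d0 by simp
  have d1: "d 1 = 0" by (simp add: d_def)
  have di: "d (of_int k) = 0" for k
    using dn[of "nat k" 1] dn[of "nat (- k)" 1] dm[of "of_int k"] d1 by (cases "k \<ge> 0") auto
  have bd: "\<bar>d c\<bar> \<le> g 1" for c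
  proof -
    have "d c = d (frac c)"
      using dadd[of "frac c" "of_int \<lfloor>c\<rfloor>"] di by (simp add: frac_def)
    moreover have "0 \<le> g (frac c)" "g (frac c) \<le> g 1"
      using pos[of "frac c"] pos[of "1 - frac c"] add[of "frac c" "1 - frac c"] frac_lt_1[of c]
      by (auto simp: frac_ge_0)
    moreover have "0 \<le> frac c * g 1" "frac c * g 1 \<le> g 1"
      using frac_lt_1[of c] frac_ge_0[of c] pos[of 1] by (auto intro: mult_left_le_one_le)
    ultimately show ?thesis
      unfolding d_def by linarith
  qed
  have "real n * \<bar>d c\<bar> \<le> g 1" for n
    using bd[of "real n * c"] by (simp add: dn abs_mult)
  then have "d c = 0"
    by (metis abs_ge_zero abs_le_zero_iff antisym_conv2 ex_less_of_nat_mult linorder_not_le)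
  then show ?thesis by (simp add: d_def)
qed

text \<open>Kantorovich's extension from the cone to the whole space. The functionals built below
  from their values on the cone (positive parts, monotone limits, null components) are all obtained
  through it.\<close>

lemma additive_positive_extension:
  fixes p :: "'a::banach_lattice \<Rightarrow> real"
  assumes add: "\<And>x y. 0 \<le> x \<Longrightarrow> 0 \<le> y \<Longrightarrow> p (x + y) = p x + p y"
    and pos: "\<And>x. 0 \<le> x \<Longrightarrow> 0 \<le> p x"
  obtains f :: "'a \<Rightarrow>\<^sub>L real" where "\<And>x. 0 \<le> x \<Longrightarrow> blinfun_apply f x = p x"
proof -
  define f where "f x = p (pprt x) - p (pprt (- x))" for x
  have p0: "p 0 = 0" using add[of 0 0] by simp
  have fp: "f x = p x" if "0 \<le> x" for x
    using that by (simp add: f_def p0)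
  have fdiff: "f x = p a - p b" if "x = a - b" "0 \<le> a" "0 \<le> b" for x a b
  proof -
    have "pprt x - pprt (- x) = a - b"
      using pprt_diff_pprt[of x] that(1) by metis
    then have "pprt x + b = a + pprt (- x)"
      by (simp add: algebra_simps)
    then have "p (pprt x) + p b = p a + p (pprt (- x))"
      using add[of "pprt x" b] add[of a "pprt (- x)"] that by simp
    then show ?thesis by (simp add: f_def)
  qed
  have fadd: "f (x + y) = f x + f y" for x y
  proof -
    have "f (x + y) = p (pprt x + pprt y) - p (pprt (- x) + pprt (- y))"
    proof (rule fdiff)
      have "x + y = (pprt x - pprt (- x)) + (pprt y - pprt (- y))"
        by (metis pprt_diff_pprt)
      then show "x + y = pprt x + pprt y - (pprt (- x) + pprt (- y))"
        by (simp add: algebra_simps)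
    qed auto
    then show ?thesis by (simp add: add f_def)
  qed
  have fpos: "0 \<le> f x" if "0 \<le> x" for x
    using that by (simp add: fp pos)
  have fmin: "f (- x) = - f x" for x
    by (simp add: f_def)
  \<comment> \<open>Homogeneity comes from additivity and positivity: along a fixed nonnegative
    direction \<open>f\<close> is an additive function of the scalar.\<close>
  have fscale0: "f (c *\<^sub>R x) = c * f x" if "0 \<le> x" for c x
    using additive_nonneg_real_linear[of "\<lambda>c. f (c *\<^sub>R x)" c] that
    by (simp add: fadd scaleR_left_distrib fpos)
  have fscale: "f (c *\<^sub>R x) = c * f x" for c x
  proof -
    have "f (c *\<^sub>R x) = f (c *\<^sub>R pprt x + - (c *\<^sub>R pprt (- x)))"
      by (metis diff_conv_add_uminus pprt_diff_pprt scaleR_diff_right)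
    also have "\<dots> = c * f (pprt x) - c * f (pprt (- x))"
      by (simp only: fadd fmin fscale0 zero_le_pprt)
    also have "\<dots> = c * f x"
      by (simp add: f_def p0 algebra_simps)
    finally show ?thesis .
  qed
  have "linear f"
    by (rule linearI) (auto simp: fadd fscale)
  then have "bounded_linear f"
    by (rule positive_linear_bounded) (rule fpos)
  then have "blinfun_apply (Blinfun f) x = p x" if "0 \<le> x" for x
    using fp that by (simp add: bounded_linear_Blinfun_apply)
  then show ?thesis using that by blast
qed

section \<open>The dual Banach lattice\<close>

text \<open>A type of its own can be made an instance of the class of Banach lattices, so that the
  construction iterates: the bidual is \<open>'a dual dual\<close>.\<close>

typedef (overloaded) 'a dual = "UNIV :: ('a::banach_lattice \<Rightarrow>\<^sub>L real) set"
  morphisms functional Dual ..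

setup_lifting type_definition_dual

lift_definition ev :: "'a::banach_lattice dual \<Rightarrow> 'a \<Rightarrow> real" is blinfun_apply .

instantiation dual :: (banach_lattice) real_normed_vector
begin

lift_definition zero_dual :: "'a dual" is 0 .
lift_definition plus_dual :: "'a dual \<Rightarrow> 'a dual \<Rightarrow> 'a dual" is "(+)" .
lift_definition minus_dual :: "'a dual \<Rightarrow> 'a dual \<Rightarrow> 'a dual" is "(-)" .
lift_definition uminus_dual :: "'a dual \<Rightarrow> 'a dual" is uminus .
lift_definition scaleR_dual :: "real \<Rightarrow> 'a dual \<Rightarrow> 'a dual" is "(*\<^sub>R)" .
lift_definition norm_dual :: "'a dual \<Rightarrow> real" is norm .
definition dist_dual :: "'a dual \<Rightarrow> 'a dual \<Rightarrow> real" where "dist_dual f g = norm (f - g)"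
definition sgn_dual :: "'a dual \<Rightarrow> 'a dual" where "sgn_dual f = inverse (norm f) *\<^sub>R f"
definition uniformity_dual :: "('a dual \<times> 'a dual) filter"
  where [code del]: "uniformity_dual = (INF e\<in>{0 <..}. principal {(x, y). dist x y < e})"
definition open_dual :: "'a dual set \<Rightarrow> bool"
  where "open_dual U = (\<forall>x\<in>U. \<forall>\<^sub>F (x', y) in uniformity. x' = x \<longrightarrow> y \<in> U)"

instance
proof
  fix a b c :: "'a dual" and r s :: real
  show "a + b + c = a + (b + c)" "a + b = b + a" "0 + a = a" "- a + a = 0" "a - b = a + - b"
    by (transfer, simp)+
  show "r *\<^sub>R (a + b) = r *\<^sub>R a + r *\<^sub>R b" "(r + s) *\<^sub>R a = r *\<^sub>R a + s *\<^sub>R a"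
    "r *\<^sub>R s *\<^sub>R a = (r * s) *\<^sub>R a" "1 *\<^sub>R a = a"
    by (transfer, simp add: algebra_simps)+
  show "norm a = 0 \<longleftrightarrow> a = 0" "norm (r *\<^sub>R a) = \<bar>r\<bar> * norm a"
    by (transfer, simp)+
  show "norm (a + b) \<le> norm a + norm b"
    by transfer (rule norm_triangle_ineq)
qed (rule dist_dual_def sgn_dual_def uniformity_dual_def open_dual_def)+

end

lemma ev_simps [simp]:
  "ev 0 x = 0" "ev (f + g) x = ev f x + ev g x" "ev (f - g) x = ev f x - ev g x"
  "ev (- f) x = - ev f x" "ev (c *\<^sub>R f) x = c * ev f x"
  by (transfer, simp add: blinfun.bilinear_simps)+

lemma bounded_linear_ev: "bounded_linear (ev f)"
  by transfer (rule blinfun.bounded_linear_right)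

lemma linear_ev: "linear (ev f)"
  using bounded_linear_ev bounded_linear.linear by blast

lemma ev_linear [simp]:
  "ev f 0 = 0" "ev f (x + y) = ev f x + ev f y" "ev f (x - y) = ev f x - ev f y"
  "ev f (- x) = - ev f x" "ev f (c *\<^sub>R x) = c * ev f x"
  using linear_ev[of f] by (simp_all add: linear_0 linear_add linear_diff linear_neg linear_scale)

lemma abs_ev_le: "\<bar>ev f x\<bar> \<le> norm f * norm x"
  by transfer (metis norm_blinfun real_norm_def)

lemma norm_dual_le:
  assumes "0 \<le> b" "\<And>x. \<bar>ev f x\<bar> \<le> b * norm x"
  shows "norm f \<le> b"
  using assms by transfer (simp add: norm_blinfun_bound)

lemma bounded_linear_imp_ev:
  assumes "bounded_linear p"
  obtains f where "\<And>x. ev f x = p x"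
proof
  show "ev (Dual (Blinfun p)) x = p x" for x
    using assms by (simp add: ev.abs_eq bounded_linear_Blinfun_apply)
qed

instance dual :: (banach_lattice) banach
proof
  fix X :: "nat \<Rightarrow> 'a dual"
  assume "Cauchy X"
  then have "Cauchy (\<lambda>n. functional (X n))"
    unfolding Cauchy_def dist_norm by transfer simp
  then obtain L where L: "(\<lambda>n. functional (X n)) \<longlonglongrightarrow> L"
    by (auto simp: Cauchy_convergent_iff convergent_def)
  have "X \<longlonglongrightarrow> Dual L"
  proof -
    have "(\<lambda>n. norm (functional (X n) - L)) \<longlonglongrightarrow> 0"
      using L by (simp add: LIM_zero_iff tendsto_norm_zero)
    moreover have "norm (functional (X n) - L) = norm (X n - Dual L)" for n
      by (simp add: norm_dual.rep_eq minus_dual.rep_eq Dual_inverse)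
    ultimately show ?thesis
      by (simp add: LIM_zero_iff tendsto_norm_zero_iff)
  qed
  then show "convergent X" by (auto simp: convergent_def)
qed

section \<open>The Riesz-Kantorovich formulas\<close>

lemma interval_add_decomp:
  fixes x y :: "'a::lattice_ab_group_add"
  assumes "w \<in> {0..x + y}" "0 \<le> x" "0 \<le> y"
  obtains a b where "w = a + b" "a \<in> {0..x}" "b \<in> {0..y}"
proof
  \<comment> \<open>Riesz decomposition: cutting \<open>w\<close> at \<open>x\<close> leaves the
    positive part of \<open>w - x\<close>, which is at most \<open>y\<close>.\<close>
  have eq: "w - inf w x = sup 0 (w - x)"
    by (simp only: diff_inf_eq_sup add_sup_distrib_left) simp
  show "w = inf w x + (w - inf w x)" by (metis add.commute diff_add_cancel)
  show "inf w x \<in> {0..x}" using assms by simp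
  show "w - inf w x \<in> {0..y}"
    using assms unfolding eq by (auto simp: algebra_simps)
qed

lemma bdd_above_ev: "bdd_above (ev f ` {0..u})"
proof (rule bdd_aboveI2)
  fix w assume w: "w \<in> {0..u}"
  have "ev f w \<le> norm f * norm w" using abs_ev_le[of f w] by simp
  also have "\<dots> \<le> norm f * norm u" using w by (intro mult_left_mono norm_mono_nonneg) auto
  finally show "ev f w \<le> norm f * norm u" .
qed

text \<open>The supremum is additive on the cone: the decomposition of order intervals gives
  \<open>\<le>\<close>, and adding two competitors gives the other inequality.\<close>

lemma ex_positive_part:
  "\<exists>p. \<forall>u\<ge>0. ev p u = (SUP w\<in>{0..u}. ev f w)"
proof -
  let ?p = "\<lambda>u. SUP w\<in>{0..u}. ev f w"
  have up: "ev f w \<le> ?p u" if "w \<in> {0..u}" for w u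
    by (rule cSUP_upper[OF that bdd_above_ev])
  have "?p (x + y) = ?p x + ?p y" if xy: "0 \<le> x" "0 \<le> y" for x y
  proof (rule antisym)
    show "?p (x + y) \<le> ?p x + ?p y"
    proof (rule cSUP_least)
      show "{0..x + y} \<noteq> {}" using xy by simp
      fix w assume "w \<in> {0..x + y}"
      then obtain a b where "w = a + b" "a \<in> {0..x}" "b \<in> {0..y}"
        using xy interval_add_decomp by blast
      then show "ev f w \<le> ?p x + ?p y"
        using up by (simp add: add_mono)
    qed
    have "?p x \<le> ?p (x + y) - ?p y"
    proof (rule cSUP_least)
      show "{0..x} \<noteq> {}" using xy by simp
      fix a assume a: "a \<in> {0..x}"
      have "?p y \<le> ?p (x + y) - ev f a"
      proof (rule cSUP_least)
        show "{0..y} \<noteq> {}" using xy by simp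
        fix b assume "b \<in> {0..y}"
        then show "ev f b \<le> ?p (x + y) - ev f a"
          using up[of "a + b" "x + y"] a by (simp add: add_mono)
      qed
      then show "ev f a \<le> ?p (x + y) - ?p y" by simp
    qed
    then show "?p x + ?p y \<le> ?p (x + y)" by simp
  qed
  moreover have "0 \<le> ?p x" if "0 \<le> x" for x
    using up[of 0 x] that by simp
  ultimately obtain g :: "'a \<Rightarrow>\<^sub>L real" where "\<And>x. 0 \<le> x \<Longrightarrow> blinfun_apply g x = ?p x"
    using additive_positive_extension[of ?p] by blast
  then show ?thesis
    by (intro exI[of _ "Dual g"]) (simp add: ev.abs_eq)
qed

definition positive_part :: "'a::banach_lattice dual \<Rightarrow> 'a dual" where
  "positive_part f = (SOME p. \<forall>u\<ge>0. ev p u = (SUP w\<in>{0..u}. ev f w))"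

lemma ev_positive_part: "0 \<le> u \<Longrightarrow> ev (positive_part f) u = (SUP w\<in>{0..u}. ev f w)"
  using someI_ex[OF ex_positive_part[of f]] by (simp add: positive_part_def)

instantiation dual :: (banach_lattice) "{ordered_real_vector, lattice}"
begin

definition less_eq_dual :: "'a dual \<Rightarrow> 'a dual \<Rightarrow> bool" where
  "less_eq_dual f g \<longleftrightarrow> (\<forall>x\<ge>0. ev f x \<le> ev g x)"
definition less_dual :: "'a dual \<Rightarrow> 'a dual \<Rightarrow> bool" where
  "less_dual f g \<longleftrightarrow> f \<le> g \<and> \<not> g \<le> f"
definition sup_dual :: "'a dual \<Rightarrow> 'a dual \<Rightarrow> 'a dual" where
  "sup_dual f g = f + positive_part (g - f)"
definition inf_dual :: "'a dual \<Rightarrow> 'a dual \<Rightarrow> 'a dual" where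
  "inf_dual f g = - sup (- f) (- g)"

instance
proof
  fix f g h :: "'a dual" and a b :: real
  show "f < g \<longleftrightarrow> f \<le> g \<and> \<not> g \<le> f" by (rule less_dual_def)
  show "f \<le> f" by (simp add: less_eq_dual_def)
  show "f \<le> g \<Longrightarrow> g \<le> h \<Longrightarrow> f \<le> h" by (force simp: less_eq_dual_def)
  show "f = g" if "f \<le> g" "g \<le> f"
  proof -
    have *: "ev f x = ev g x" if "0 \<le> x" for x
      using \<open>f \<le> g\<close> \<open>g \<le> f\<close> that by (auto simp: less_eq_dual_def intro: antisym)
    have "ev f x = ev g x" for x
      by (subst (1 2) pprt_diff_pprt[of x]) (simp add: *)
    then show ?thesis by transfer (rule blinfun_eqI)
  qed
  show "f \<le> g \<Longrightarrow> h + f \<le> h + g" by (simp add: less_eq_dual_def)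
  show "f \<le> g \<Longrightarrow> 0 \<le> a \<Longrightarrow> a *\<^sub>R f \<le> a *\<^sub>R g" by (simp add: less_eq_dual_def mult_left_mono)
  show "a \<le> b \<Longrightarrow> 0 \<le> f \<Longrightarrow> a *\<^sub>R f \<le> b *\<^sub>R f" by (simp add: less_eq_dual_def mult_right_mono)
  have sup1: "f \<le> sup f g" for f g :: "'a dual"
  proof -
    have "0 \<le> ev (positive_part (g - f)) x" if "0 \<le> x" for x
      using cSUP_upper[OF _ bdd_above_ev, of 0 x "g - f"] that by (simp add: ev_positive_part)
    then show ?thesis by (simp add: less_eq_dual_def sup_dual_def)
  qed
  have sup2: "g \<le> sup f g" for f g :: "'a dual"
  proof -
    have "ev (g - f) x \<le> ev (positive_part (g - f)) x" if "0 \<le> x" for x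
      using cSUP_upper[OF _ bdd_above_ev, of x x "g - f"] that by (simp only: ev_positive_part) auto
    then show ?thesis by (force simp: less_eq_dual_def sup_dual_def)
  qed
  have sup3: "sup f g \<le> h" if "f \<le> h" "g \<le> h" for f g h :: "'a dual"
  proof -
    have "ev (positive_part (g - f)) x \<le> ev (h - f) x" if x: "0 \<le> x" for x
      unfolding ev_positive_part[OF x]
    proof (rule cSUP_least)
      show "{0..x} \<noteq> {}" using x by simp
      fix w assume w: "w \<in> {0..x}"
      have "ev (g - f) w \<le> ev (h - f) w"
        using \<open>g \<le> h\<close> w by (simp add: less_eq_dual_def)
      also have "\<dots> \<le> ev (h - f) w + ev (h - f) (x - w)"
        using \<open>f \<le> h\<close>[unfolded less_eq_dual_def, rule_format, of "x - w"] w by simp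
      finally show "ev (g - f) w \<le> ev (h - f) x" by simp
    qed
    then show ?thesis by (force simp: less_eq_dual_def sup_dual_def)
  qed
  show "f \<le> sup f g" "g \<le> sup f g" by (rule sup1 sup2)+
  show "g \<le> f \<Longrightarrow> h \<le> f \<Longrightarrow> sup g h \<le> f" by (rule sup3)
  have neg: "- f \<le> - g" if "g \<le> f" for f g :: "'a dual"
    using that by (simp add: less_eq_dual_def)
  have neg': "f \<le> - g" if "g \<le> - f" for f g :: "'a dual"
    using that by (force simp add: less_eq_dual_def)
  have neg'': "- g \<le> f" if "- f \<le> g" for f g :: "'a dual"
    using that by (force simp add: less_eq_dual_def)
  show "inf f g \<le> f" "inf f g \<le> g"
    unfolding inf_dual_def by (rule neg'', rule sup1) (rule neg'', rule sup2)
  show "f \<le> g \<Longrightarrow> f \<le> h \<Longrightarrow> f \<le> inf g h"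
    unfolding inf_dual_def by (rule neg', rule sup3) (rule neg, assumption)+
qed

end

lemma dual_le_iff: "f \<le> g \<longleftrightarrow> (\<forall>x\<ge>0. ev f x \<le> ev g x)"
  by (rule less_eq_dual_def)

lemma ev_mono: "f \<le> g \<Longrightarrow> 0 \<le> x \<Longrightarrow> ev f x \<le> ev g x"
  by (simp add: dual_le_iff)

lemma ev_nonneg: "0 \<le> f \<Longrightarrow> 0 \<le> x \<Longrightarrow> 0 \<le> ev f x"
  using ev_mono[of 0 f x] by simp

lemma ev_mono_arg: "0 \<le> f \<Longrightarrow> x \<le> y \<Longrightarrow> ev f x \<le> ev f y"
  using ev_nonneg[of f "y - x"] by simp

lemma sup_dual_eq: "sup f g = f + positive_part (g - f)" for f g :: "'a::banach_lattice dual"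
  by (rule sup_dual_def)

text \<open>By the Riesz-Kantorovich formula, the absolute value of \<open>g\<close> at
  \<open>u\<close> is the supremum of \<open>g (u - 2w)\<close> over
  \<open>0 \<le> w \<le> u\<close>. Since \<open>u - 2w\<close> lies between \<open>- u\<close> and
  \<open>u\<close>, this is at most \<open>norm g * norm u\<close>.\<close>

instance dual :: (banach_lattice) banach_lattice
proof
  fix f g :: "'a dual"
  assume le: "sup f (- f) \<le> sup g (- g)"
  have bound: "ev (sup g (- g)) u \<le> norm g * norm u" if u: "0 \<le> u" for u
  proof -
    have "ev (positive_part (- g - g)) u \<le> norm g * norm u - ev g u"
      unfolding ev_positive_part[OF u]
    proof (rule cSUP_least)
      show "{0..u} \<noteq> {}" using u by simp
      fix w assume w: "w \<in> {0..u}"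
      have "u - w - w \<le> u" "- (u - w - w) \<le> u"
        using w add_mono[of 0 w 0 w] add_mono[of w u w u] by (auto simp: algebra_simps)
      then have "norm (u - w - w) \<le> norm u"
        by (rule norm_mono_interval)
      then have "ev g (u - w - w) \<le> norm g * norm u"
        by (meson abs_ev_le abs_le_D1 mult_left_mono norm_ge_zero order_trans)
      then show "ev (- g - g) w \<le> norm g * norm u - ev g u"
        by simp
    qed
    then show ?thesis by (simp add: sup_dual_eq)
  qed
  show "norm f \<le> norm g"
  proof (rule norm_dual_le)
    fix x
    let ?a = "sup f (- f)"
    have a: "f \<le> ?a" "- f \<le> ?a" by auto
    have "\<bar>ev f x\<bar> \<le> ev ?a (pprt x) + ev ?a (pprt (- x))"
    proof -
      have "ev f x = ev f (pprt x) - ev f (pprt (- x))"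
        by (metis ev_linear(3) pprt_diff_pprt)
      then show ?thesis
        using ev_mono[OF a(1), of "pprt x"] ev_mono[OF a(1), of "pprt (- x)"]
          ev_mono[OF a(2), of "pprt x"] ev_mono[OF a(2), of "pprt (- x)"] by simp
    qed
    also have "\<dots> = ev ?a (sup x (- x))" by (simp add: sup_minus_self)
    also have "\<dots> \<le> ev (sup g (- g)) (sup x (- x))"
      by (rule ev_mono[OF le nonneg_sup_minus_self])
    also have "\<dots> \<le> norm g * norm (sup x (- x))"
      by (rule bound[OF nonneg_sup_minus_self])
    finally show "\<bar>ev f x\<bar> \<le> norm g * norm x" by simp
  qed simp
qed

lemma positive_part_eq_pprt: "positive_part f = pprt f"
  using sup_dual_eq[of 0 f] by (simp add: pprt_def sup_commute)

lemma ev_pprt_le_iff: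
  assumes "0 \<le> u"
  shows "ev (pprt f) u \<le> c \<longleftrightarrow> (\<forall>w\<in>{0..u}. ev f w \<le> c)"
proof -
  have "{0..u} \<noteq> {}" using assms by simp
  then show ?thesis
    unfolding positive_part_eq_pprt[symmetric] ev_positive_part[OF assms]
    by (rule cSUP_le_iff[OF _ bdd_above_ev])
qed

text \<open>The value of an infimum at \<open>u\<close> is the infimum of
  \<open>ev f w + ev g (u - w)\<close> over the splittings of \<open>u\<close>. This turns lattice
  relations between functionals into concrete elements of the underlying space.\<close>

lemma ev_inf_approx:
  assumes "0 \<le> u" "ev (inf f g) u < c"
  obtains w where "0 \<le> w" "w \<le> u" "ev f w + ev g (u - w) < c"
proof -
  have "inf f g = g - pprt (g - f)"
    by (simp add: pprt_def diff_sup_eq_inf add_inf_distrib_left)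
  then have "\<not> ev (pprt (g - f)) u \<le> ev g u - c"
    using assms(2) by simp
  then obtain w where "w \<in> {0..u}" "ev (g - f) w > ev g u - c"
    using assms(1) by (force simp: ev_pprt_le_iff)
  then show ?thesis
    by (intro that[of w]) auto
qed

lemma positive_linear_imp_ev:
  assumes "linear p" "\<And>x. 0 \<le> x \<Longrightarrow> 0 \<le> p x"
  obtains f where "0 \<le> f" "\<And>x. ev f x = p x"
proof -
  have "bounded_linear p" by (rule positive_linear_bounded) (use assms in auto)
  then obtain f where "\<And>x. ev f x = p x" using bounded_linear_imp_ev by blast
  then show ?thesis
    using assms(2) by (intro that[of f]) (auto simp: dual_le_iff)
qed

lemma additive_imp_ev:
  assumes "\<And>x y. 0 \<le> x \<Longrightarrow> 0 \<le> y \<Longrightarrow> p (x + y) = p x + p y"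
    and "\<And>x. 0 \<le> x \<Longrightarrow> 0 \<le> p x"
  obtains f where "0 \<le> f" "\<And>x. 0 \<le> x \<Longrightarrow> ev f x = p x"
proof -
  obtain g :: "'a \<Rightarrow>\<^sub>L real" where "\<And>x. 0 \<le> x \<Longrightarrow> blinfun_apply g x = p x"
    using additive_positive_extension[of p] assms by blast
  then show ?thesis
    using assms(2) by (intro that[of "Dual g"]) (auto simp: dual_le_iff ev.abs_eq)
qed

section \<open>Approximating order-bounded elements of the bidual\<close>

definition bidual :: "'a::banach_lattice \<Rightarrow> 'a dual dual" where
  "bidual x = Dual (Blinfun (\<lambda>f. ev f x))"

lemma ev_bidual [simp]: "ev (bidual x) f = ev f x"
proof -
  have "bounded_linear (\<lambda>f. ev f x)"
    by (rule bounded_linear_intro[where K = "norm x"]) (auto simp: abs_ev_le)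
  then show ?thesis
    by (simp add: bidual_def ev.abs_eq bounded_linear_Blinfun_apply)
qed

lemma dual_eqI: "(\<And>x. ev f x = ev g x) \<Longrightarrow> f = g"
  by transfer (rule blinfun_eqI)

lemma bidual_add: "bidual (x + y) = bidual x + bidual y"
  by (rule dual_eqI) simp

lemma bidual_scaleR: "bidual (c *\<^sub>R x) = c *\<^sub>R bidual x"
  by (rule dual_eqI) simp

lemma bidual_mono: "x \<le> y \<Longrightarrow> bidual x \<le> bidual y"
  by (simp add: dual_le_iff ev_mono_arg)

lemma bidual_nonneg: "0 \<le> x \<Longrightarrow> 0 \<le> bidual x"
  by (simp add: dual_le_iff)

lemma abs_ev_le_ev_sup:
  assumes "0 \<le> h"
  shows "\<bar>ev d h\<bar> \<le> ev (sup d (- d)) h"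
  using ev_mono[OF sup_ge1[of d "- d"] assms] ev_mono[OF sup_ge2[of "- d" d] assms] by simp

lemma pprt_disjoint: "inf (pprt y) (pprt (- y)) = (0::'a::lattice_ab_group_add)"
proof -
  have "inf (y + pprt (- y)) (0 + pprt (- y)) = inf y 0 + pprt (- y)"
    by (rule add_inf_distrib_right[symmetric])
  also have "\<dots> = nprt y - nprt y" by (simp only: pprt_neg flip: nprt_def) simp
  finally show ?thesis
    using pprt_diff_pprt[of y] by (metis add.left_neutral add_diff_cancel_right' diff_add_cancel diff_self)
qed

lemma diff_inf_eq_pprt: "a - inf a b = pprt (a - b)" for a b :: "'a::lattice_ab_group_add"
  by (simp only: diff_inf_eq_sup add_sup_distrib_left pprt_def) (simp add: sup_commute)

text \<open>
  Splitting \<open>h\<close> along the disjoint pair \<open>\<beta>\<close>, \<open>x - \<alpha>\<close> gives two functionals whose infimum is small at \<open>x\<close>;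
  splitting \<open>x\<close> along those two gives \<open>y\<close>.
\<close>

lemma disjoint_layers_approx:
  fixes \<alpha> \<beta> :: "'a::banach_lattice dual dual"
  assumes "0 \<le> \<beta>" "\<beta> \<le> \<alpha>" "\<alpha> \<le> bidual x" "inf \<beta> (bidual x - \<alpha>) = 0"
    and x: "0 \<le> x" and h: "0 \<le> h" and \<eta>: "0 < \<eta>"
  obtains y where
    "ev (sup (\<alpha> - bidual y) (- (\<alpha> - bidual y))) h \<le> \<eta> + 2 * (ev \<alpha> h - ev \<beta> h)"
proof -
  \<comment> \<open>One \<open>\<epsilon>\<close> is spent on splitting \<open>h\<close> and two on
    splitting \<open>x\<close>. The gap \<open>\<delta>\<close> between \<open>\<alpha>\<close> and
    \<open>\<beta>\<close> is paid twice: for the size of \<open>inf k l\<close> at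
    \<open>x\<close>, and for replacing \<open>\<alpha>\<close> by \<open>\<beta>\<close> on
    \<open>k\<close>.\<close>
  define \<epsilon> where "\<epsilon> = \<eta> / 3"
  have \<epsilon>: "0 < \<epsilon>" using \<eta> by (simp add: \<epsilon>_def)
  define \<delta> where "\<delta> = ev \<alpha> h - ev \<beta> h"
  obtain k where k: "0 \<le> k" "k \<le> h" "ev \<beta> k + ev (bidual x - \<alpha>) (h - k) < \<epsilon>"
    using ev_inf_approx[of h \<beta> "bidual x - \<alpha>" \<epsilon>] assms \<epsilon> by auto
  define l where "l = h - k"
  have l: "0 \<le> l" "l \<le> h" using k by (auto simp: l_def)
  have kl: "ev \<beta> k + ev (bidual x - \<alpha>) l < \<epsilon>" using k by (simp add: l_def)
  have \<beta>k: "0 \<le> ev \<beta> k" using assms k by (simp add: ev_nonneg)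
  have \<alpha>l: "0 \<le> ev (bidual x - \<alpha>) l" using assms l by (intro ev_nonneg) auto
  have \<delta>mono: "ev \<alpha> m - ev \<beta> m \<le> \<delta>" if "m \<le> h" for m
    using ev_mono_arg[of "\<alpha> - \<beta>" m h] that assms by (simp add: \<delta>_def)
  define m where "m = inf k l"
  \<comment> \<open>Because \<open>m\<close> lies below \<open>k\<close> and \<open>l\<close>, the
    splitting of \<open>h\<close> makes the first and the last summand small; the middle one is at
    most \<open>\<delta>\<close>.\<close>
  have "ev m x = ev (bidual x - \<alpha>) m + (ev \<alpha> m - ev \<beta> m) + ev \<beta> m"
    by simp
  also have "\<dots> \<le> ev (bidual x - \<alpha>) l + \<delta> + ev \<beta> k"
  proof (intro add_mono)
    show "ev (bidual x - \<alpha>) m \<le> ev (bidual x - \<alpha>) l"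
      using assms by (intro ev_mono_arg) (auto simp: m_def)
    show "ev \<beta> m \<le> ev \<beta> k"
      using assms by (intro ev_mono_arg) (auto simp: m_def)
    show "ev \<alpha> m - ev \<beta> m \<le> \<delta>"
      by (rule \<delta>mono) (use k in \<open>auto simp: m_def intro: le_infI1\<close>)
  qed
  finally have "ev (inf k l) x < \<delta> + 2 * \<epsilon>"
    using kl \<epsilon> by (simp add: m_def)
  then obtain y where y: "0 \<le> y" "y \<le> x" "ev k y + ev l (x - y) < \<delta> + 2 * \<epsilon>"
    using ev_inf_approx[OF x] by blast
  let ?d = "sup (\<alpha> - bidual y) (- (\<alpha> - bidual y))"
  have \<alpha>0: "0 \<le> \<alpha>" using assms by (meson order_trans)
  have "?d \<le> (bidual x - \<alpha>) + bidual (x - y)"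
  proof (rule sup_least)
    show "\<alpha> - bidual y \<le> (bidual x - \<alpha>) + bidual (x - y)"
      by (rule order_trans[of _ "bidual x - bidual y"])
         (use assms in \<open>auto simp: dual_le_iff\<close>)
    show "- (\<alpha> - bidual y) \<le> (bidual x - \<alpha>) + bidual (x - y)"
      using bidual_mono[OF y(2)] by (auto simp: dual_le_iff)
  qed
  from ev_mono[OF this l(1)] have 1: "ev ?d l \<le> ev (bidual x - \<alpha>) l + ev l (x - y)"
    by simp
  have "?d \<le> \<alpha> + bidual y"
    by (intro sup_least) (use \<alpha>0 bidual_nonneg[OF y(1)] in \<open>auto simp: dual_le_iff\<close>)
  from ev_mono[OF this k(1)] have 2: "ev ?d k \<le> ev \<alpha> k + ev k y"
    by simp
  have "ev ?d h = ev ?d k + ev ?d l"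
    by (simp add: l_def)
  also have "\<dots> \<le> \<eta> + 2 * \<delta>"
    using 1 2 kl y(3) \<delta>mono[OF k(2)] \<beta>k \<alpha>l unfolding \<epsilon>_def by linarith
  finally show ?thesis
    using that by (simp add: \<delta>_def)
qed

text \<open>
  The errors \<open>2 (\<alpha> - \<beta>)(h)\<close> of successive layers telescope.
\<close>

lemma multilayer_approx:
  fixes a :: "'a::banach_lattice dual dual"
  assumes x: "0 \<le> x" and h: "0 \<le> h" and \<eta>: "0 < \<eta>"
  shows "0 \<le> a \<Longrightarrow> a \<le> real n *\<^sub>R bidual x \<Longrightarrow>
    \<exists>y. ev (sup (a - bidual y) (- (a - bidual y))) h \<le> real n * \<eta> + 2 * ev (inf a (bidual x)) h"
proof (induction n arbitrary: a)
  case 0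
  then have "a = 0" by (simp add: antisym)
  moreover have "bidual 0 = (0 :: 'a dual dual)" by (rule dual_eqI) simp
  ultimately show ?case
    using bidual_nonneg[OF x] by (intro exI[of _ 0]) (simp add: inf_absorb1)
next
  case (Suc n)
  let ?X = "bidual x"
  have X: "0 \<le> ?X" by (rule bidual_nonneg[OF x])
  \<comment> \<open>Removing the bottom layer \<open>inf a ?X\<close> leaves \<open>a'\<close>,
    which fits under one multiple of \<open>?X\<close> fewer.\<close>
  define a' where "a' = pprt (a - ?X)"
  have a'_eq: "a' = a - inf a ?X"
    by (simp only: a'_def diff_inf_eq_pprt)
  have "a' \<le> real n *\<^sub>R ?X"
    unfolding a'_def
    by (rule pprt_least) (use Suc.prems X in \<open>auto simp: algebra_simps\<close>)
  moreover have "0 \<le> a'" by (simp add: a'_def)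
  ultimately obtain y' where y': "ev (sup (a' - bidual y') (- (a' - bidual y'))) h
      \<le> real n * \<eta> + 2 * ev (inf a' ?X) h"
    using Suc.IH by blast
  have a'a: "a' \<le> a"
    unfolding a'_def by (rule pprt_least) (use Suc.prems X in auto)
  \<comment> \<open>Consecutive layers have the required disjointness: the upper one lies below the
    positive part of \<open>a - ?X\<close>, and the gap that the lower one leaves under
    \<open>?X\<close> is its negative part.\<close>
  have disj: "inf (inf a' ?X) (?X - inf a ?X) = 0"
  proof (rule antisym)
    have "?X - inf a ?X = pprt (- (a - ?X))"
      using diff_inf_eq_pprt[of ?X a] by (simp only: inf_commute minus_diff_eq)
    then have "inf (inf a' ?X) (?X - inf a ?X) \<le> inf (pprt (a - ?X)) (pprt (- (a - ?X)))"
      unfolding a'_def by (metis inf.cobounded1 inf_mono order_refl)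
    then show "inf (inf a' ?X) (?X - inf a ?X) \<le> 0"
      by (simp only: pprt_disjoint)
    have "0 \<le> ?X - inf a ?X" by (metis diff_ge_0_iff_ge inf_le2)
    then show "0 \<le> inf (inf a' ?X) (?X - inf a ?X)"
      using \<open>0 \<le> a'\<close> X by (meson le_infI)
  qed
  obtain y where y: "ev (sup (inf a ?X - bidual y) (- (inf a ?X - bidual y))) h
      \<le> \<eta> + 2 * (ev (inf a ?X) h - ev (inf a' ?X) h)"
  proof (rule disjoint_layers_approx[OF _ _ _ disj x h \<eta>])
    show "0 \<le> inf a' ?X" using \<open>0 \<le> a'\<close> X by simp
    show "inf a' ?X \<le> inf a ?X" using a'a by (rule inf_mono) simp
    show "inf a ?X \<le> ?X" by simp
  qed
  let ?u = "inf a ?X - bidual y" and ?v = "a' - bidual y'"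
  have eq: "a - bidual (y + y') = ?u + ?v"
    unfolding a'_eq bidual_add by (simp only: algebra_simps)
  have "sup (?u + ?v) (- (?u + ?v)) \<le> sup ?u (- ?u) + sup ?v (- ?v)"
    unfolding minus_add_distrib by (intro sup_least add_mono sup_ge1 sup_ge2)
  then have "ev (sup (?u + ?v) (- (?u + ?v))) h \<le> ev (sup ?u (- ?u)) h + ev (sup ?v (- ?v)) h"
    using ev_mono[OF _ h] by (metis ev_simps(2))
  also have "\<dots> \<le> real (Suc n) * \<eta> + 2 * ev (inf a ?X) h"
    using add_mono[OF y y'] by (simp only: of_nat_Suc) (simp only: algebra_simps mult_1_right mult_1_left)
  finally show ?case
    unfolding eq[symmetric] by blast
qed

text \<open>Applied to \<open>n\<close> times \<open>\<phi>\<close>, the layer estimate has the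
  error \<open>n * (\<epsilon> / 2)\<close> plus a term that stays below \<open>2 * ev h x\<close>
  whatever \<open>n\<close> is. Dividing by \<open>n\<close> makes that term negligible.\<close>

lemma bidual_approx:
  fixes \<phi> :: "'a::banach_lattice dual dual"
  assumes x: "0 \<le> x" and \<phi>: "0 \<le> \<phi>" "\<phi> \<le> bidual x" and h: "0 \<le> h" and \<epsilon>: "0 < \<epsilon>"
  obtains y where "ev (sup (\<phi> - bidual y) (- (\<phi> - bidual y))) h \<le> \<epsilon>"
proof -
  have xh: "0 \<le> ev h x" using h x by (rule ev_nonneg)
  obtain n :: nat where n: "n > 0" "2 * ev h x < real n * (\<epsilon> / 2)"
    using ex_less_of_nat_mult[of "\<epsilon> / 2" "2 * ev h x"] \<epsilon> xh
    by (metis half_gt_zero mult_zero_left neq0_conv not_numeral_less_zero of_nat_0 linorder_not_le mult_nonneg_nonneg zero_le_numeral)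
  have "\<exists>y. ev (sup (real n *\<^sub>R \<phi> - bidual y) (- (real n *\<^sub>R \<phi> - bidual y))) h
    \<le> real n * (\<epsilon> / 2) + 2 * ev (inf (real n *\<^sub>R \<phi>) (bidual x)) h"
    using \<epsilon> \<phi> by (intro multilayer_approx x h scaleR_nonneg scaleR_left_mono) auto
  then obtain y where y: "ev (sup (real n *\<^sub>R \<phi> - bidual y) (- (real n *\<^sub>R \<phi> - bidual y))) h
    \<le> real n * (\<epsilon> / 2) + 2 * ev (inf (real n *\<^sub>R \<phi>) (bidual x)) h" ..
  let ?y = "(1 / real n) *\<^sub>R y"
  let ?s = "sup (real n *\<^sub>R \<phi> - bidual y) (- (real n *\<^sub>R \<phi> - bidual y))"
  have eq: "\<phi> - bidual ?y = (1 / real n) *\<^sub>R (real n *\<^sub>R \<phi> - bidual y)"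
    using n by (simp add: bidual_scaleR scaleR_diff_right)
  have "sup (\<phi> - bidual ?y) (- (\<phi> - bidual ?y)) \<le> (1 / real n) *\<^sub>R ?s"
    unfolding eq scaleR_minus_right[symmetric]
    by (intro sup_least scaleR_left_mono sup_ge1 sup_ge2) auto
  from ev_mono[OF this h] have "ev (sup (\<phi> - bidual ?y) (- (\<phi> - bidual ?y))) h \<le> ev ?s h / real n"
    by simp
  also have "\<dots> \<le> \<epsilon>"
  proof -
    have "ev (inf (real n *\<^sub>R \<phi>) (bidual x)) h \<le> ev h x"
      using ev_mono[OF inf_le2 h] by (metis ev_bidual)
    then have "ev ?s h \<le> real n * \<epsilon>"
      using y n(2) by linarith
    then show ?thesis using n by (simp add: field_simps)
  qed
  finally show ?thesis using that by blast
qed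

section \<open>Order continuity and the band generated by the space in its bidual\<close>

text \<open>Directed sets and not only sequences, because some families below are indexed by the
  whole positive cone. Together with positivity, the last condition on \<open>D\<close> says that
  its infimum is 0.\<close>

definition order_continuous_norm :: "'b::banach_lattice itself \<Rightarrow> bool" where
  "order_continuous_norm _ \<longleftrightarrow>
     (\<forall>D :: 'b set.
        D \<noteq> {} \<and> (\<forall>f\<in>D. \<forall>g\<in>D. \<exists>h\<in>D. h \<le> f \<and> h \<le> g)
        \<and> (\<forall>f\<in>D. 0 \<le> f) \<and> (\<forall>h. (\<forall>f\<in>D. h \<le> f) \<longrightarrow> h \<le> 0)
        \<longrightarrow> (\<forall>\<epsilon>>0. \<exists>f\<in>D. norm f < \<epsilon>))"

lemma order_continuous_ev_small:
  fixes \<phi> :: "'b::banach_lattice dual"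
  assumes oc: "order_continuous_norm TYPE('b)"
    and D: "D \<noteq> {}" "\<And>f g. f \<in> D \<Longrightarrow> g \<in> D \<Longrightarrow> \<exists>h\<in>D. h \<le> f \<and> h \<le> g"
      "\<And>f. f \<in> D \<Longrightarrow> 0 \<le> f" "\<And>h. (\<And>f. f \<in> D \<Longrightarrow> h \<le> f) \<Longrightarrow> h \<le> 0"
    and \<epsilon>: "0 < \<epsilon>"
  obtains f where "f \<in> D" "ev \<phi> f < \<epsilon>"
proof -
  have "\<forall>\<epsilon>>0. \<exists>f\<in>D. norm f < \<epsilon>"
  proof (rule oc[unfolded order_continuous_norm_def, THEN spec, THEN mp], intro conjI ballI allI impI)
    show "D \<noteq> {}" by (rule D)
    show "\<exists>h\<in>D. h \<le> f \<and> h \<le> g" if "f \<in> D" "g \<in> D" for f g using that by (rule D)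
    show "0 \<le> f" if "f \<in> D" for f using that by (rule D)
    show "h \<le> 0" if "\<forall>f\<in>D. h \<le> f" for h using that by (intro D(4)) blast
  qed
  \<comment> \<open>The summand 1 keeps the quotient meaningful when \<open>\<phi>\<close> is
    0.\<close>
  then obtain f where f: "f \<in> D" "norm f < \<epsilon> / (norm \<phi> + 1)"
    using \<epsilon> by (metis add_nonneg_pos divide_pos_pos norm_ge_zero zero_less_one)
  have "ev \<phi> f \<le> norm \<phi> * norm f" using abs_ev_le[of \<phi> f] by simp
  also have "\<dots> \<le> (norm \<phi> + 1) * norm f" by (intro mult_right_mono) auto
  also have "\<dots> < \<epsilon>"
    using f(2) by (simp add: pos_less_divide_eq add_nonneg_pos mult.commute)
  finally show ?thesis using f that by blast
qed

text \<open>Pointwise limits on the cone are additive there and hence extend to a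
  functional.\<close>

lemma dual_decseq_limit:
  fixes f :: "nat \<Rightarrow> 'a::banach_lattice dual"
  assumes dec: "\<And>n. f (Suc n) \<le> f n" and pos: "\<And>n. 0 \<le> f n"
  shows "\<exists>r\<ge>0. (\<forall>n. r \<le> f n) \<and> (\<forall>x\<ge>0. (\<lambda>n. ev (f n) x) \<longlonglongrightarrow> ev r x)"
proof -
  have dc: "decseq (\<lambda>n. ev (f n) x)" if "0 \<le> x" for x
    by (rule decseq_SucI) (rule ev_mono[OF dec that])
  have "\<exists>l. (\<lambda>n. ev (f n) x) \<longlonglongrightarrow> l" if x: "0 \<le> x" for x
    using decseq_convergent[OF dc[OF x], of 0] ev_nonneg[OF pos x] by blast
  then obtain p where p: "\<And>x. 0 \<le> x \<Longrightarrow> (\<lambda>n. ev (f n) x) \<longlonglongrightarrow> p x" by metis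
  obtain r where r: "0 \<le> r" "\<And>x. 0 \<le> x \<Longrightarrow> ev r x = p x"
  proof (rule additive_imp_ev[of p])
    show "p (x + y) = p x + p y" if "0 \<le> x" "0 \<le> y" for x y
      using tendsto_add[OF p[OF that(1)] p[OF that(2)]] p[of "x + y"] that
      by (intro LIMSEQ_unique[of "\<lambda>n. ev (f n) (x + y)"]) auto
    show "0 \<le> p x" if "0 \<le> x" for x
      by (rule LIMSEQ_le_const[OF p[OF that]]) (use ev_nonneg[OF pos that] in auto)
  qed blast
  show ?thesis
  proof (intro exI[of _ r] conjI allI impI)
    show "0 \<le> r" by (rule r)
    show "(\<lambda>n. ev (f n) x) \<longlonglongrightarrow> ev r x" if "0 \<le> x" for x
      using p r that by simp
    show "r \<le> f n" for n
      using decseq_ge[OF dc p] r(2) by (simp add: dual_le_iff)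
  qed
qed

text \<open>The finite suprema increase below \<open>h\<close>, so their distances to
  \<open>h\<close> decrease to some \<open>r\<close>, and the supremum is \<open>h - r\<close>. The
  last clause is countable subadditivity, from bounding a finite supremum of nonnegative elements by
  their sum; it later makes an upper limit vanish at \<open>x\<close>.\<close>

lemma dual_countable_sup:
  fixes f :: "nat \<Rightarrow> 'a::banach_lattice dual"
  assumes pos: "\<And>n. 0 \<le> f n" and le: "\<And>n. f n \<le> h"
  shows "\<exists>t. (\<forall>n. f n \<le> t) \<and> (\<forall>g. (\<forall>n. f n \<le> g) \<longrightarrow> t \<le> g) \<and>
    (\<forall>x\<ge>0. summable (\<lambda>n. ev (f n) x) \<longrightarrow> ev t x \<le> (\<Sum>n. ev (f n) x))"
proof -
  define S where "S = rec_nat (f 0) (\<lambda>n s. sup s (f (Suc n)))"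
  have S0: "S 0 = f 0" and SS: "S (Suc n) = sup (S n) (f (Suc n))" for n
    by (simp_all add: S_def)
  have fS: "f n \<le> S n" for n by (cases n) (auto simp: S0 SS)
  have S_least: "S n \<le> g" if "\<And>n. f n \<le> g" for n g
    by (induction n) (auto simp: S0 SS that)
  have Spos: "0 \<le> S n" for n by (rule order_trans[OF pos fS])
  have Sh: "S n \<le> h" for n by (rule S_least[OF le])
  have Ssum: "ev (S n) x \<le> (\<Sum>i\<le>n. ev (f i) x)" if x: "0 \<le> x" for n x
  proof (induction n)
    case (Suc n)
    have "S (Suc n) \<le> S n + f (Suc n)"
      using Spos[of n] pos[of "Suc n"] by (simp add: SS)
    from ev_mono[OF this x] Suc show ?case by simp
  qed (simp add: S0)
  obtain r where r: "0 \<le> r" "\<And>n. r \<le> h - S n"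
      "\<And>x. 0 \<le> x \<Longrightarrow> (\<lambda>n. ev (h - S n) x) \<longlonglongrightarrow> ev r x"
  proof -
    have "h - S (Suc n) \<le> h - S n" for n by (rule diff_left_mono) (simp add: SS)
    moreover have "0 \<le> h - S n" for n using Sh by simp
    ultimately have "\<exists>r\<ge>0. (\<forall>n. r \<le> h - S n) \<and> (\<forall>x\<ge>0. (\<lambda>n. ev (h - S n) x) \<longlonglongrightarrow> ev r x)"
      by (rule dual_decseq_limit)
    then show ?thesis using that by blast
  qed
  have lim: "(\<lambda>n. ev (S n) x) \<longlonglongrightarrow> ev (h - r) x" if "0 \<le> x" for x
    using tendsto_diff[OF tendsto_const[of "ev h x"] r(3)[OF that]] by simp
  show ?thesis
  proof (intro exI[of _ "h - r"] conjI allI impI)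
    show "f n \<le> h - r" for n
    proof -
      have "S n \<le> h - r" using r(2)[of n] by (simp add: le_diff_eq add.commute)
      with fS show ?thesis by (rule order_trans)
    qed
    show "h - r \<le> g" if "\<forall>n. f n \<le> g" for g
      unfolding dual_le_iff
      by (intro allI impI LIMSEQ_le_const2[OF lim])
         (use ev_mono[OF S_least[OF that[rule_format]]] in auto)
    show "ev (h - r) x \<le> (\<Sum>n. ev (f n) x)" if x: "0 \<le> x" and s: "summable (\<lambda>n. ev (f n) x)" for x
    proof (rule LIMSEQ_le_const2[OF lim[OF x]], intro exI allI impI)
      fix n
      have "(\<Sum>i\<le>n. ev (f i) x) \<le> (\<Sum>n. ev (f n) x)"
        by (rule sum_le_suminf[OF s]) (use ev_nonneg[OF pos x] in auto)
      with Ssum[OF x, of n] show "ev (S n) x \<le> (\<Sum>n. ev (f n) x)" by simp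
    qed
  qed
qed

text \<open>
  On the positive cone, \<open>k u = inf\<^sub>n h ((u - n x)\<^sup>+)\<close>: the part of \<open>h\<close> disjoint from \<open>x\<close>.
\<close>

lemma null_component:
  fixes h :: "'a::banach_lattice dual"
  assumes h: "0 \<le> h" and x: "0 \<le> x"
  obtains k where "0 \<le> k" "k \<le> h" "ev k x = 0"
    "\<And>r. 0 \<le> r \<Longrightarrow> r \<le> h \<Longrightarrow> ev r x = 0 \<Longrightarrow> r \<le> k"
proof -
  define q where "q n u = ev h (pprt (u - real n *\<^sub>R x))" for n u
  have qpos: "0 \<le> q n u" for n u by (simp add: q_def ev_nonneg h)
  have "q (Suc n) u \<le> q n u" for n u
    unfolding q_def using x by (intro ev_mono_arg[OF h] pprt_mono) (simp add: algebra_simps)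
  then have dc: "decseq (\<lambda>n. q n u)" for u by (rule decseq_SucI)
  have "\<exists>l. (\<lambda>n. q n u) \<longlonglongrightarrow> l" for u
    using decseq_convergent[OF dc, of 0] qpos by blast
  then obtain p where p: "\<And>u. (\<lambda>n. q n u) \<longlonglongrightarrow> p u" by metis
  have p_nonneg: "0 \<le> p u" for u
    by (rule LIMSEQ_le_const[OF p]) (use qpos in auto)
  obtain k where k: "0 \<le> k" "\<And>x. 0 \<le> x \<Longrightarrow> ev k x = p x"
  proof (rule additive_imp_ev[of p])
    show "0 \<le> p x" for x by (rule p_nonneg)
    fix u v :: 'a assume uv: "0 \<le> u" "0 \<le> v"
    show "p (u + v) = p u + p v"
    proof (rule antisym)
      \<comment> \<open>Doubling the index provides \<open>n\<close> copies of \<open>x\<close> for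
        each of \<open>u\<close> and \<open>v\<close>; along even indices the limit is the
        same.\<close>
      have "q (n * 2) (u + v) \<le> q n u + q n v" for n
      proof -
        let ?a = "u - real n *\<^sub>R x" and ?b = "v - real n *\<^sub>R x"
        have "pprt (?a + ?b) \<le> pprt ?a + pprt ?b"
          by (rule pprt_least) (auto intro: add_mono pprt_ge)
        moreover have "u + v - real (n * 2) *\<^sub>R x = ?a + ?b"
          by (simp add: algebra_simps scaleR_2 flip: scaleR_scaleR)
        ultimately show ?thesis
          using ev_mono_arg[OF h] unfolding q_def by (metis ev_linear(2))
      qed
      moreover have "(\<lambda>n. q (n * 2) (u + v)) \<longlonglongrightarrow> p (u + v)"
        using LIMSEQ_linear[OF p, of 2] by simp
      ultimately show "p (u + v) \<le> p u + p v"
        by (intro LIMSEQ_le[OF _ tendsto_add[OF p p]]) auto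
      have "q n u + q n v \<le> q n (u + v)" for n
      proof -
        let ?a = "u - real n *\<^sub>R x" and ?b = "v - real n *\<^sub>R x"
        let ?c = "pprt (u + v - real n *\<^sub>R x)"
        have nx: "0 \<le> real n *\<^sub>R x" using x by simp
        have c: "u + v - real n *\<^sub>R x \<le> ?c" "0 \<le> ?c" by (auto simp: pprt_ge)
        have 1: "?a \<le> ?c" "?b \<le> ?c"
          by (rule order_trans[OF _ c(1)], use uv in simp)+
        have 2: "?a + ?b \<le> ?c"
          by (rule order_trans[OF _ c(1)]) (use nx in \<open>simp add: algebra_simps\<close>)
        \<comment> \<open>The sum of the two positive parts is the supremum of
          \<open>?a + ?b\<close>, \<open>?a\<close>, \<open>?b\<close> and 0, each of which is at
          most \<open>?c\<close>.\<close>
        have "pprt ?a + pprt ?b = sup (?a + pprt ?b) (0 + pprt ?b)"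
          by (subst (1) pprt_def) (rule add_sup_distrib_right)
        also have "?a + pprt ?b = sup (?a + ?b) (?a + 0)"
          unfolding pprt_def by (rule add_sup_distrib_left)
        finally have "pprt ?a + pprt ?b \<le> ?c"
          using 1 2 c(2) by (simp add: pprt_least)
        from ev_mono_arg[OF h this] show ?thesis by (simp add: q_def)
      qed
      then show "p u + p v \<le> p (u + v)"
        by (intro LIMSEQ_le[OF tendsto_add[OF p p] p]) auto
    qed
  qed blast
  show ?thesis
  proof
    show "0 \<le> k" by (rule k)
    have "p u \<le> ev h u" if "0 \<le> u" for u
      using decseq_ge[OF dc p, of u 0] that by (simp add: q_def)
    then show "k \<le> h" by (simp add: dual_le_iff k)
    have "p x \<le> 0"
      using decseq_ge[OF dc p, of x 1] by (simp add: q_def)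
    then show "ev k x = 0" using p_nonneg[of x] k(2)[OF x] by simp
    fix r assume r: "0 \<le> r" "r \<le> h" "ev r x = 0"
    \<comment> \<open>As \<open>r\<close> vanishes at \<open>x\<close>, subtracting copies of
      \<open>x\<close> from \<open>u\<close> does not change its value.\<close>
    have "ev r u \<le> p u" if "0 \<le> u" for u
    proof (rule LIMSEQ_le_const[OF p], intro exI allI impI)
      fix n
      have "u - real n *\<^sub>R x \<le> pprt (u - real n *\<^sub>R x)" by (rule pprt_ge)
      from ev_mono_arg[OF r(1) this] have "ev r u \<le> ev r (pprt (u - real n *\<^sub>R x))"
        using r(3) by simp
      also have "\<dots> \<le> q n u" unfolding q_def by (rule ev_mono[OF r(2)]) simp
      finally show "ev r u \<le> q n u" .
    qed
    then show "r \<le> k" by (simp add: dual_le_iff k)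
  qed
qed

text \<open>A Borel-Cantelli argument: \<open>r\<close> is the upper limit of the
  \<open>k j\<close>, the infimum over \<open>m\<close> of the suprema \<open>T m\<close> of the
  tails. Geometric decay at \<open>x\<close> forces \<open>ev r x = 0\<close>. Since
  \<open>\<phi>\<close> need not respect infima by itself, the lower bound on
  \<open>ev \<phi> r\<close> is drawn from order continuity of the norm.\<close>

lemma null_limit:
  fixes \<phi> :: "'a::banach_lattice dual dual"
  assumes oc: "order_continuous_norm TYPE('a dual)"
    and \<phi>: "0 \<le> \<phi>" and x: "0 \<le> x"
    and k: "\<And>j. 0 \<le> k j" "\<And>j. k j \<le> h" "\<And>j. ev (k j) x \<le> c * (1/2) ^ j" "\<And>j. \<epsilon> \<le> ev \<phi> (k j)"
  obtains r where "0 \<le> r" "r \<le> h" "ev r x = 0" "\<epsilon> \<le> ev \<phi> r"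
proof -
  have "\<exists>t. (\<forall>j. k (j + m) \<le> t) \<and> (\<forall>g. (\<forall>j. k (j + m) \<le> g) \<longrightarrow> t \<le> g) \<and> ev t x \<le> c * (1/2) ^ m * 2" for m
  proof -
    obtain t where t: "\<And>n. k (n + m) \<le> t" "\<And>g. (\<forall>n. k (n + m) \<le> g) \<Longrightarrow> t \<le> g"
        "\<And>x. 0 \<le> x \<Longrightarrow> summable (\<lambda>n. ev (k (n + m)) x) \<Longrightarrow> ev t x \<le> (\<Sum>n. ev (k (n + m)) x)"
      using dual_countable_sup[of "\<lambda>n. k (n + m)" h, OF k(1) k(2)] by metis
    have le: "ev (k (n + m)) x \<le> c * (1/2) ^ m * (1/2) ^ n" for n
      using k(3)[of "n + m"] by (simp add: power_add mult_ac)
    have sg: "summable (\<lambda>n. c * (1/2) ^ m * (1/2::real) ^ n)"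
      by (intro summable_mult) simp
    have s: "summable (\<lambda>n. ev (k (n + m)) x)"
      by (rule summable_comparison_test'[OF sg, of 0]) (use le ev_nonneg[OF k(1) x] in auto)
    have "ev t x \<le> (\<Sum>n. ev (k (n + m)) x)" by (rule t(3)[OF x s])
    also have "\<dots> \<le> (\<Sum>n. c * (1/2) ^ m * (1/2) ^ n)" by (rule suminf_le[OF le s sg])
    also have "\<dots> = c * (1/2) ^ m * 2"
      by (subst suminf_mult) (auto simp: suminf_geometric)
    finally show ?thesis using t by blast
  qed
  then obtain T where T: "\<And>m j. k (j + m) \<le> T m" "\<And>m g. (\<And>j. k (j + m) \<le> g) \<Longrightarrow> T m \<le> g"
      "\<And>m. ev (T m) x \<le> c * (1/2) ^ m * 2"
    by metis
  have kT: "k m \<le> T m" for m using T(1)[of 0 m] by simp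
  have Th: "T m \<le> h" for m by (rule T(2)) (rule k(2))
  have Tpos: "0 \<le> T m" for m by (rule order_trans[OF k(1) kT])
  have Tdec: "T (Suc m) \<le> T m" for m
    using T(1)[of "Suc _" m] by (intro T(2)) simp
  then have Tanti: "T n \<le> T m" if "m \<le> n" for m n
    using lift_Suc_antimono_le[of T m n] that by blast
  obtain r where r: "0 \<le> r" "\<And>n. r \<le> T n" "\<And>x. 0 \<le> x \<Longrightarrow> (\<lambda>n. ev (T n) x) \<longlonglongrightarrow> ev r x"
    using dual_decseq_limit[of T, OF Tdec Tpos] by metis
  show ?thesis
  proof
    show "0 \<le> r" "r \<le> h" using r Th order_trans by blast+
    have lim: "(\<lambda>m. c * (1/2) ^ m * 2) \<longlonglongrightarrow> c * 0 * 2"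
      by (intro tendsto_intros LIMSEQ_power_zero) auto
    have "ev r x \<le> c * 0 * 2"
      by (rule LIMSEQ_le[OF r(3)[OF x] lim]) (use T(3) in blast)
    then show "ev r x = 0" using ev_nonneg[OF r(1) x] by simp
    show "\<epsilon> \<le> ev \<phi> r"
    proof (rule field_le_epsilon)
      fix \<delta> :: real assume \<delta>: "0 < \<delta>"
      \<comment> \<open>The differences \<open>T m - r\<close> decrease to 0, so
        \<open>\<phi>\<close> is small on one of them, while \<open>T m\<close> dominates
        \<open>k m\<close>.\<close>
      obtain f where "f \<in> range (\<lambda>m. T m - r)" "ev \<phi> f < \<delta>"
      proof (rule order_continuous_ev_small[OF oc, of "range (\<lambda>m. T m - r)" \<delta> \<phi>])
        show "\<exists>h\<in>range (\<lambda>m. T m - r). h \<le> f \<and> h \<le> g"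
          if fg: "f \<in> range (\<lambda>m. T m - r)" "g \<in> range (\<lambda>m. T m - r)" for f g
        proof -
          obtain i j where "f = T i - r" "g = T j - r" using fg by auto
          then show ?thesis
            using Tanti[of i "max i j"] Tanti[of j "max i j"] by (intro bexI[of _ "T (max i j) - r"]) auto
        qed
        show "l \<le> 0" if l: "\<And>f. f \<in> range (\<lambda>m. T m - r) \<Longrightarrow> l \<le> f" for l
          unfolding dual_le_iff
        proof (intro allI impI)
          fix u :: 'a assume u: "0 \<le> u"
          have lim: "(\<lambda>m. ev (T m - r) u) \<longlonglongrightarrow> 0"
            using tendsto_diff[OF r(3)[OF u] tendsto_const[of "ev r u"]] by simp
          have "ev l u \<le> 0"
            by (rule LIMSEQ_le_const[OF lim]) (use ev_mono[OF l u] in blast)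
          then show "ev l u \<le> ev 0 u" by simp
        qed
      qed (use r \<delta> in auto)
      then obtain m where "ev \<phi> (T m - r) < \<delta>" by auto
      then show "\<epsilon> \<le> ev \<phi> r + \<delta>"
        using k(4)[of m] ev_mono_arg[OF \<phi> kT[of m]] by simp
    qed
  qed
qed

text \<open>If the remainder stayed at least \<open>\<epsilon>\<close> for every
  \<open>x \<ge> 0\<close>, then \<open>\<phi>\<close> would be at least
  \<open>\<epsilon> / 2\<close> on \<open>\<kappa> x\<close>, the largest functional below
  \<open>h\<close> that vanishes at \<open>x\<close>. But these functionals decrease to 0 as
  \<open>x\<close> grows.\<close>

lemma bidual_band:
  fixes \<phi> :: "'a::banach_lattice dual dual"
  assumes oc: "order_continuous_norm TYPE('a dual)"
    and \<phi>: "0 \<le> \<phi>" and h: "0 \<le> h" and \<epsilon>: "0 < \<epsilon>"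
  obtains x where "0 \<le> x" "ev (pprt (\<phi> - bidual x)) h < \<epsilon>"
proof (rule ccontr)
  assume "\<not> thesis"
  then have big: "\<epsilon> \<le> ev (pprt (\<phi> - bidual x)) h" if "0 \<le> x" for x
    using that \<open>\<And>x. 0 \<le> x \<Longrightarrow> ev (pprt (\<phi> - bidual x)) h < \<epsilon> \<Longrightarrow> thesis\<close>[of x] by linarith
  have "\<forall>x. \<exists>k. 0 \<le> x \<longrightarrow> 0 \<le> k \<and> k \<le> h \<and> ev k x = 0 \<and> (\<forall>r. 0 \<le> r \<longrightarrow> r \<le> h \<longrightarrow> ev r x = 0 \<longrightarrow> r \<le> k)"
    using null_component[OF h] by metis
  then obtain \<kappa> where \<kappa>: "\<And>x. 0 \<le> x \<Longrightarrow> 0 \<le> \<kappa> x" "\<And>x. 0 \<le> x \<Longrightarrow> \<kappa> x \<le> h"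
      "\<And>x. 0 \<le> x \<Longrightarrow> ev (\<kappa> x) x = 0"
      "\<And>x r. 0 \<le> x \<Longrightarrow> 0 \<le> r \<Longrightarrow> r \<le> h \<Longrightarrow> ev r x = 0 \<Longrightarrow> r \<le> \<kappa> x"
    by metis
  have \<kappa>big: "\<epsilon> / 2 \<le> ev \<phi> (\<kappa> x)" if x: "0 \<le> x" for x
  proof -
    \<comment> \<open>Testing the assumption at \<open>2 ^ j *\<^sub>R x\<close> forces the witness
      \<open>k\<close> to be at most of order \<open>(1/2) ^ j\<close> at \<open>x\<close>. Halving
      \<open>\<epsilon>\<close> gives the strict inequality that produces a witness between 0 and
      \<open>h\<close>.\<close>
    have "\<exists>k. 0 \<le> k \<and> k \<le> h \<and> ev k x \<le> ev \<phi> h * (1/2) ^ j \<and> \<epsilon> / 2 \<le> ev \<phi> k" for j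
    proof -
      have "\<not> ev (pprt (\<phi> - bidual (2 ^ j *\<^sub>R x))) h \<le> \<epsilon> / 2"
        using big[of "2 ^ j *\<^sub>R x"] x \<epsilon> by simp
      then obtain k where k: "0 \<le> k" "k \<le> h" "ev (\<phi> - bidual (2 ^ j *\<^sub>R x)) k > \<epsilon> / 2"
        unfolding ev_pprt_le_iff[OF h] by auto
      have kx: "ev k x \<ge> 0" by (rule ev_nonneg[OF k(1) x])
      have "2 ^ j * ev k x \<le> ev \<phi> h"
        using k(3) \<epsilon> ev_mono_arg[OF \<phi> k(2)] by simp
      then have "ev k x \<le> ev \<phi> h * (1/2) ^ j"
        by (simp add: field_simps power_one_over)
      moreover have "\<epsilon> / 2 \<le> ev \<phi> k"
        using k(3) mult_nonneg_nonneg[OF zero_le_power[of "2::real" j] kx] by simp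
      ultimately show ?thesis using k by blast
    qed
    then obtain k where k: "\<And>j. 0 \<le> k j" "\<And>j. k j \<le> h" "\<And>j. ev (k j) x \<le> ev \<phi> h * (1/2) ^ j"
        "\<And>j. \<epsilon> / 2 \<le> ev \<phi> (k j)"
      by metis
    obtain r where r: "0 \<le> r" "r \<le> h" "ev r x = 0" "\<epsilon> / 2 \<le> ev \<phi> r"
      by (rule null_limit[OF oc \<phi> x k])
    have "ev \<phi> r \<le> ev \<phi> (\<kappa> x)"
      by (rule ev_mono_arg[OF \<phi> \<kappa>(4)[OF x r(1-3)]])
    with r(4) show ?thesis by simp
  qed
  have \<kappa>anti: "\<kappa> (x + y) \<le> \<kappa> x" if "0 \<le> x" "0 \<le> y" for x y
  proof (rule \<kappa>(4)[OF that(1)])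
    have xy: "0 \<le> x + y" using that by simp
    show "0 \<le> \<kappa> (x + y)" "\<kappa> (x + y) \<le> h" using \<kappa> xy by auto
    show "ev (\<kappa> (x + y)) x = 0"
      using \<kappa>(3)[OF xy] ev_nonneg[OF \<kappa>(1)[OF xy] that(1)] ev_nonneg[OF \<kappa>(1)[OF xy] that(2)] by simp
  qed
  obtain f where "f \<in> \<kappa> ` {0..}" "ev \<phi> f < \<epsilon> / 2"
  proof (rule order_continuous_ev_small[OF oc, of "\<kappa> ` {0..}" "\<epsilon> / 2" \<phi>])
    show "\<exists>h\<in>\<kappa> ` {0..}. h \<le> f \<and> h \<le> g" if fg: "f \<in> \<kappa> ` {0..}" "g \<in> \<kappa> ` {0..}" for f g
    proof -
      obtain x where "0 \<le> x" "f = \<kappa> x" using fg(1) by auto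
      moreover obtain y where "0 \<le> y" "g = \<kappa> y" using fg(2) by auto
      ultimately show ?thesis
        using \<kappa>anti[of x y] \<kappa>anti[of y x]
        by (intro bexI[of _ "\<kappa> (x + y)"]) (auto simp: add.commute)
    qed
    \<comment> \<open>A lower bound \<open>l\<close> lies below \<open>\<kappa> u\<close>, which
      vanishes at \<open>u\<close> itself.\<close>
    show "l \<le> 0" if "\<And>f. f \<in> \<kappa> ` {0..} \<Longrightarrow> l \<le> f" for l
      unfolding dual_le_iff
    proof (intro allI impI)
      fix u :: 'a assume u: "0 \<le> u"
      then have "l \<le> \<kappa> u" using that by simp
      then show "ev l u \<le> ev 0 u" using ev_mono[OF _ u] \<kappa>(3)[OF u] by (metis ev_simps(1))
    qed
  qed (use \<kappa> \<epsilon> in auto)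
  then obtain x where "0 \<le> x" "ev \<phi> (\<kappa> x) < \<epsilon> / 2" by auto
  with \<kappa>big[of x] show False by simp
qed

section \<open>Commutation of positive functionals on the dual\<close>

definition adj :: "('a::banach_lattice \<Rightarrow> 'b::banach_lattice) \<Rightarrow> 'b dual \<Rightarrow> 'a dual" where
  "adj R \<phi> = Dual (Blinfun (\<lambda>v. ev \<phi> (R v)))"

lemma ev_adj [simp]:
  assumes "bounded_linear R"
  shows "ev (adj R \<phi>) v = ev \<phi> (R v)"
proof -
  have "bounded_linear (\<lambda>v. ev \<phi> (R v))"
    by (rule bounded_linear_compose[OF bounded_linear_ev assms])
  then show ?thesis
    by (simp add: adj_def ev.abs_eq bounded_linear_Blinfun_apply)
qed

text \<open>The two readings of a positive bilinear form \<open>b\<close>: \<open>R v\<close> is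
  \<open>b(-, v)\<close> and \<open>S u\<close> is \<open>b(u, -)\<close>. Thus
  \<open>ev \<phi> (adj S \<psi>)\<close> and \<open>ev \<psi> (adj R \<phi>)\<close> are its two
  iterated extensions to the biduals, and exchanging \<open>R\<close> with \<open>S\<close>
  interchanges the two variables.\<close>

locale positive_bilinear =
  fixes R :: "'b::banach_lattice \<Rightarrow> 'a::banach_lattice dual" and S :: "'a \<Rightarrow> 'b dual"
  assumes linear_R: "linear R" and linear_S: "linear S"
    and R_nonneg: "0 \<le> v \<Longrightarrow> 0 \<le> R v"
    and transpose: "ev (S u) v = ev (R v) u"
begin

lemma S_nonneg: "0 \<le> u \<Longrightarrow> 0 \<le> S u"
  by (simp add: dual_le_iff[of 0 "S u"] transpose ev_nonneg R_nonneg)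

lemma bounded_linear_R: "bounded_linear R"
  by (rule positive_linear_bounded[OF linear_R R_nonneg])

lemma bounded_linear_S: "bounded_linear S"
  by (rule positive_linear_bounded[OF linear_S S_nonneg])

lemmas ev_adj_R = ev_adj[OF bounded_linear_R] and ev_adj_S = ev_adj[OF bounded_linear_S]

lemma adj_R_minus: "adj R (- \<phi>) = - adj R \<phi>"
  by (rule dual_eqI) (simp add: ev_adj_R)

lemma adj_R_add: "adj R (\<phi> + \<psi>) = adj R \<phi> + adj R \<psi>"
  by (rule dual_eqI) (simp add: ev_adj_R)

lemma adj_R_mono: "\<phi> \<le> \<psi> \<Longrightarrow> adj R \<phi> \<le> adj R \<psi>"
  by (simp add: dual_le_iff[of "adj R \<phi>"] ev_adj_R ev_mono R_nonneg)

lemma adj_R_bidual: "adj R (bidual x) = S x"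
  by (rule dual_eqI) (simp add: ev_adj_R transpose)

text \<open>Only \<open>\<phi>\<close> is approximated: for \<open>bidual y\<close> in its place
  both sides are \<open>ev \<psi> (S y)\<close>. The error \<open>d\<close> is controlled on both
  sides by the same number \<open>ev D (R z)\<close>, because \<open>adj S \<psi>\<close> lies below
  \<open>R z\<close> and \<open>\<psi>\<close> below \<open>bidual z\<close>.\<close>

lemma arens_commute_ideal:
  assumes \<phi>: "0 \<le> \<phi>" "\<phi> \<le> bidual x" and \<psi>: "0 \<le> \<psi>" "\<psi> \<le> bidual z"
    and x: "0 \<le> x" and z: "0 \<le> z"
  shows "ev \<phi> (adj S \<psi>) = ev \<psi> (adj R \<phi>)"
proof -
  have "\<bar>ev \<phi> (adj S \<psi>) - ev \<psi> (adj R \<phi>)\<bar> \<le> 0"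
  proof (rule field_le_epsilon)
    fix \<epsilon> :: real assume \<epsilon>: "0 < \<epsilon>"
    have Rz: "0 \<le> R z" by (rule R_nonneg[OF z])
    obtain y where y: "ev (sup (\<phi> - bidual y) (- (\<phi> - bidual y))) (R z) \<le> \<epsilon> / 2"
      using bidual_approx[OF x \<phi> Rz, of "\<epsilon> / 2"] \<epsilon> by auto
    define d where "d = \<phi> - bidual y"
    define D where "D = sup d (- d)"
    have D: "0 \<le> D" "d \<le> D" "- d \<le> D"
      unfolding D_def by (simp_all add: nonneg_sup_minus_self del: neg_sup_eq_inf)
    have \<phi>eq: "\<phi> = d + bidual y" by (simp add: d_def)
    have S\<psi>: "0 \<le> adj S \<psi>" "adj S \<psi> \<le> R z"
      using ev_nonneg[OF \<psi>(1) S_nonneg] ev_mono[OF \<psi>(2) S_nonneg]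
      by (auto simp: dual_le_iff ev_adj_S transpose)
    have "\<bar>ev d (adj S \<psi>)\<bar> \<le> ev D (adj S \<psi>)"
      unfolding D_def by (rule abs_ev_le_ev_sup[OF S\<psi>(1)])
    also have "\<dots> \<le> ev D (R z)"
      by (rule ev_mono_arg[OF D(1) S\<psi>(2)])
    finally have 1: "\<bar>ev d (adj S \<psi>)\<bar> \<le> ev D (R z)" .
    have "\<bar>ev \<psi> (adj R d)\<bar> \<le> ev \<psi> (adj R D)"
      using ev_mono_arg[OF \<psi>(1) adj_R_mono[OF D(2)]] ev_mono_arg[OF \<psi>(1) adj_R_mono[OF D(3)]]
      by (simp add: adj_R_minus abs_le_iff)
    also have "\<dots> \<le> ev (bidual z) (adj R D)"
    proof (rule ev_mono[OF \<psi>(2)])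
      show "0 \<le> adj R D"
        using ev_nonneg[OF D(1) R_nonneg] by (simp add: dual_le_iff ev_adj_R)
    qed
    also have "\<dots> = ev D (R z)" by (simp add: ev_adj_R)
    finally have 2: "\<bar>ev \<psi> (adj R d)\<bar> \<le> ev D (R z)" .
    have "ev \<phi> (adj S \<psi>) - ev \<psi> (adj R \<phi>) = ev d (adj S \<psi>) - ev \<psi> (adj R d)"
      unfolding \<phi>eq adj_R_add by (simp add: adj_R_bidual ev_adj_S)
    then show "\<bar>ev \<phi> (adj S \<psi>) - ev \<psi> (adj R \<phi>)\<bar> \<le> 0 + \<epsilon>"
      using 1 2 y unfolding D_def[symmetric] d_def[symmetric] by linarith
  qed
  then show ?thesis by simp
qed

text \<open>The last bound is the band property at the functional \<open>adj S \<psi>\<close>. For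
  the other one, the images of the remainders under \<open>adj R\<close> decrease to 0 in
  \<open>'b dual\<close>, by the band property at each \<open>R v\<close>; order continuity of that
  norm makes \<open>\<psi>\<close> small on one of them.\<close>

lemma remainder_small:
  assumes oc: "order_continuous_norm TYPE('a dual)" "order_continuous_norm TYPE('b dual)"
    and \<phi>: "0 \<le> \<phi>" and \<psi>: "0 \<le> \<psi>" and \<epsilon>: "0 < \<epsilon>"
  obtains x where "0 \<le> x" "ev \<psi> (adj R (pprt (\<phi> - bidual x))) < \<epsilon>"
    "ev (pprt (\<phi> - bidual x)) (adj S \<psi>) < \<epsilon>"
proof -
  let ?r = "\<lambda>x. pprt (\<phi> - bidual x)"
  have S\<psi>: "0 \<le> adj S \<psi>"
    using ev_nonneg[OF \<psi> S_nonneg] by (simp add: dual_le_iff ev_adj_S)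
  have r_anti: "?r (x + y) \<le> ?r x" if "0 \<le> y" for x y
    using bidual_nonneg[OF that] by (intro pprt_mono) (simp add: bidual_add algebra_simps)
  obtain x1 where x1: "0 \<le> x1" "ev (?r x1) (adj S \<psi>) < \<epsilon>"
    using bidual_band[OF oc(1) \<phi> S\<psi> \<epsilon>] by blast
  obtain f where "f \<in> (\<lambda>x. adj R (?r x)) ` {0..}" "ev \<psi> f < \<epsilon>"
  proof (rule order_continuous_ev_small[OF oc(2), of "(\<lambda>x. adj R (?r x)) ` {0..}" \<epsilon> \<psi>])
    fix f g
    assume fg: "f \<in> (\<lambda>x. adj R (?r x)) ` {0..}" "g \<in> (\<lambda>x. adj R (?r x)) ` {0..}"
    obtain x where x: "0 \<le> x" "f = adj R (?r x)" using fg(1) by auto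
    obtain y where y: "0 \<le> y" "g = adj R (?r y)" using fg(2) by auto
    have "adj R (?r (x + y)) \<le> f" "adj R (?r (x + y)) \<le> g"
      using adj_R_mono[OF r_anti[OF y(1), of x]] adj_R_mono[OF r_anti[OF x(1), of y]] x y
      by (auto simp: add.commute)
    then show "\<exists>h\<in>(\<lambda>x. adj R (?r x)) ` {0..}. h \<le> f \<and> h \<le> g"
      using x(1) y(1) by (intro bexI[of _ "adj R (?r (x + y))"]) auto
  next
    fix f assume "f \<in> (\<lambda>x. adj R (?r x)) ` {0..}"
    then obtain x where "f = adj R (?r x)" by auto
    then show "0 \<le> f"
      using ev_nonneg[OF zero_le_pprt R_nonneg] by (simp add: dual_le_iff ev_adj_R)
  next
    fix l assume l: "\<And>f. f \<in> (\<lambda>x. adj R (?r x)) ` {0..} \<Longrightarrow> l \<le> f"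
    have "ev l v \<le> 0" if v: "0 \<le> v" for v
    proof (rule field_le_epsilon)
      fix \<delta> :: real assume "0 < \<delta>"
      then obtain x where x: "0 \<le> x" "ev (?r x) (R v) < \<delta>"
        using bidual_band[OF oc(1) \<phi> R_nonneg[OF v]] by blast
      have "l \<le> adj R (?r x)" using l x(1) by simp
      from ev_mono[OF this v] x(2) show "ev l v \<le> 0 + \<delta>" by (simp add: ev_adj_R)
    qed
    then show "l \<le> 0" by (simp add: dual_le_iff)
  qed (use \<epsilon> in auto)
  then obtain x2 where x2: "0 \<le> x2" "ev \<psi> (adj R (?r x2)) < \<epsilon>" by auto
  show ?thesis
  proof
    \<comment> \<open>Remainders shrink as \<open>x\<close> grows, so the sum serves both
      bounds.\<close>
    show "0 \<le> x1 + x2" using x1 x2 by simp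
    show "ev (?r (x1 + x2)) (adj S \<psi>) < \<epsilon>"
      using ev_mono[OF r_anti[OF x2(1), of x1] S\<psi>] x1(2) by simp
    show "ev \<psi> (adj R (?r (x1 + x2))) < \<epsilon>"
      using ev_mono_arg[OF \<psi> adj_R_mono[OF r_anti[OF x1(1), of x2]]] x2(2) by (simp add: add.commute)
  qed
qed

lemma arens_commute_reduce:
  assumes oc: "order_continuous_norm TYPE('a dual)" "order_continuous_norm TYPE('b dual)"
    and \<phi>: "0 \<le> \<phi>" and \<psi>: "0 \<le> \<psi>"
    and ideal: "\<And>\<phi>' x. 0 \<le> x \<Longrightarrow> 0 \<le> \<phi>' \<Longrightarrow> \<phi>' \<le> bidual x \<Longrightarrow> ev \<phi>' (adj S \<psi>) = ev \<psi> (adj R \<phi>')"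
  shows "ev \<phi> (adj S \<psi>) = ev \<psi> (adj R \<phi>)"
proof -
  have "\<bar>ev \<phi> (adj S \<psi>) - ev \<psi> (adj R \<phi>)\<bar> \<le> 0"
  proof (rule field_le_epsilon)
    fix \<epsilon> :: real assume \<epsilon>: "0 < \<epsilon>"
    obtain x where x: "0 \<le> x" "ev \<psi> (adj R (pprt (\<phi> - bidual x))) < \<epsilon>"
      "ev (pprt (\<phi> - bidual x)) (adj S \<psi>) < \<epsilon>"
      using remainder_small[OF oc \<phi> \<psi> \<epsilon>] by blast
    define r where "r = pprt (\<phi> - bidual x)"
    define \<phi>' where "\<phi>' = inf \<phi> (bidual x)"
    have r: "0 \<le> r" by (simp add: r_def)
    have eq: "\<phi> = r + \<phi>'" unfolding r_def \<phi>'_def diff_inf_eq_pprt[symmetric] by (rule diff_add_cancel[symmetric])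
    have "ev \<phi>' (adj S \<psi>) = ev \<psi> (adj R \<phi>')"
      by (rule ideal[OF x(1)]) (use \<phi> bidual_nonneg[OF x(1)] in \<open>auto simp: \<phi>'_def\<close>)
    then have "ev \<phi> (adj S \<psi>) - ev \<psi> (adj R \<phi>) = ev r (adj S \<psi>) - ev \<psi> (adj R r)"
      unfolding eq adj_R_add by simp
    moreover have "0 \<le> ev r (adj S \<psi>)" "0 \<le> ev \<psi> (adj R r)"
      using ev_nonneg[OF \<psi> S_nonneg] ev_nonneg[OF r R_nonneg]
      by (auto intro!: ev_nonneg r \<psi> simp: dual_le_iff ev_adj_S ev_adj_R)
    ultimately show "\<bar>ev \<phi> (adj S \<psi>) - ev \<psi> (adj R \<phi>)\<bar> \<le> 0 + \<epsilon>"
      using x unfolding r_def[symmetric] by linarith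
  qed
  then show ?thesis by simp
qed

end

theorem (in positive_bilinear) arens_commute:
  assumes oc: "order_continuous_norm TYPE('a dual)" "order_continuous_norm TYPE('b dual)"
    and \<phi>: "0 \<le> \<phi>" and \<psi>: "0 \<le> \<psi>"
  shows "ev \<phi> (adj S \<psi>) = ev \<psi> (adj R \<phi>)"
proof -
  interpret flip: positive_bilinear S R
    by (intro positive_bilinear.intro linear_R linear_S S_nonneg transpose[symmetric])
  show ?thesis
  proof (rule arens_commute_reduce[OF oc \<phi> \<psi>])
    fix \<phi>' :: "'a dual dual" and x assume *: "0 \<le> x" "0 \<le> \<phi>'" "\<phi>' \<le> bidual x"
    \<comment> \<open>The same reduction with the variables exchanged truncates
      \<open>\<psi>\<close>, while \<open>\<phi>'\<close> already lies below an element of the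
      space.\<close>
    have "ev \<psi> (adj R \<phi>') = ev \<phi>' (adj S \<psi>)"
      by (rule flip.arens_commute_reduce[OF oc(2,1) \<psi> *(2)], rule flip.arens_commute_ideal) (use * in auto)
    then show "ev \<phi>' (adj S \<psi>) = ev \<psi> (adj R \<phi>')" ..
  qed
qed

section \<open>Operators between duals acting on one slot\<close>

lemma dle_iff: "dle f g \<longleftrightarrow> Dual f \<le> Dual g"
  by (simp add: dle_def dual_le_iff ev.abs_eq)

lemma dle_functional: "dle (functional f) (functional g) \<longleftrightarrow> f \<le> g"
  by (simp add: dle_iff functional_inverse)

lemma order_continuous_norm_dual:
  assumes oc: "dual_order_continuous TYPE('a::banach_lattice)"
  shows "order_continuous_norm TYPE('a dual)"
  unfolding order_continuous_norm_def
proof (intro allI impI, elim conjE)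
  fix D :: "'a dual set" and \<epsilon> :: real
  assume D: "D \<noteq> {}" "\<forall>f\<in>D. \<forall>g\<in>D. \<exists>h\<in>D. h \<le> f \<and> h \<le> g" "\<forall>f\<in>D. 0 \<le> f"
    "\<forall>h. (\<forall>f\<in>D. h \<le> f) \<longrightarrow> h \<le> 0" and \<epsilon>: "0 < \<epsilon>"
  have "\<forall>\<epsilon>>0. \<exists>f\<in>functional ` D. norm f < \<epsilon>"
  proof (rule oc[unfolded dual_order_continuous_def, THEN spec, THEN mp], intro conjI ballI allI impI)
    show "functional ` D \<noteq> {}" using D(1) by simp
    show "\<exists>h\<in>functional ` D. dle h f \<and> dle h g" if "f \<in> functional ` D" "g \<in> functional ` D" for f g
      using that D(2) by (auto simp: dle_functional)
    show "dle 0 f" if "f \<in> functional ` D" for f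
      using that D(3) by (auto simp: dle_functional simp flip: zero_dual.rep_eq)
    show "dle h 0" if h: "\<forall>f\<in>functional ` D. dle h f" for h
    proof -
      have "\<forall>f\<in>D. Dual h \<le> f" using h by (simp add: dle_iff functional_inverse)
      then have "Dual h \<le> 0" using D(4) by blast
      then show ?thesis by (simp add: dle_iff flip: zero_dual_def)
    qed
  qed
  then show "\<exists>f\<in>D. norm f < \<epsilon>" using \<epsilon> by (auto simp: norm_dual.rep_eq)
qed

lemma linear_Dual_comp:
  assumes "linear T"
  shows "linear (\<lambda>f. Dual (T (functional f)))"
  by (rule linearI)
     (simp_all add: plus_dual.rep_eq scaleR_dual.rep_eq linear_add[OF assms] linear_scale[OF assms]
       plus_dual.abs_eq scaleR_dual.abs_eq)

lemma positive_blinfun_operator_bounded: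
  fixes T :: "('a::banach_lattice \<Rightarrow>\<^sub>L real) \<Rightarrow> ('b::banach_lattice \<Rightarrow>\<^sub>L real)"
  assumes lin: "linear T" and pos: "\<And>f. dle 0 f \<Longrightarrow> dle 0 (T f)"
  shows "bounded_linear T"
proof -
  have "bounded_linear (\<lambda>f. Dual (T (functional f)))"
  proof (rule positive_linear_bounded[OF linear_Dual_comp[OF lin]])
    fix f :: "'a dual" assume "0 \<le> f"
    then have "dle 0 (functional f)" by (simp add: dle_functional flip: zero_dual.rep_eq)
    from pos[OF this] show "0 \<le> Dual (T (functional f))"
      by (simp add: dle_iff flip: zero_dual_def)
  qed
  then obtain K where K: "\<And>f. norm (Dual (T (functional f))) \<le> norm f * K"
    using bounded_linear.bounded by blast
  have "norm (T f) \<le> norm f * K" for f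
    using K[of "Dual f"] by (simp add: norm_dual.abs_eq Dual_inverse)
  then show ?thesis
    by (intro bounded_linear_intro[where K = K]) (auto simp: linear_add[OF lin] linear_scale[OF lin])
qed

text \<open>The theorem assumes order continuity of one dual, but the transfer uses it for the
  source and its inverse for the target. Directedness and infima pass along an order isomorphism;
  small norms do because \<open>T\<close>, being positive, is bounded.\<close>

lemma dual_order_continuous_transport:
  fixes T :: "('a::banach_lattice \<Rightarrow>\<^sub>L real) \<Rightarrow> ('b::banach_lattice \<Rightarrow>\<^sub>L real)"
  assumes "linear T" "bij T" and le: "\<And>f g. dle f g \<longleftrightarrow> dle (T f) (T g)"
    and oc: "dual_order_continuous TYPE('a)"
  shows "dual_order_continuous TYPE('b)"
  unfolding dual_order_continuous_def
proof (intro allI impI, elim conjE)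
  fix D :: "('b \<Rightarrow>\<^sub>L real) set" and \<epsilon> :: real
  assume D: "D \<noteq> {}" "\<forall>f\<in>D. \<forall>g\<in>D. \<exists>h\<in>D. dle h f \<and> dle h g" "\<forall>f\<in>D. dle 0 f"
    "\<forall>h. (\<forall>f\<in>D. dle h f) \<longrightarrow> dle h 0" and \<epsilon>: "0 < \<epsilon>"
  have T0: "T 0 = 0" by (rule linear_0[OF assms(1)])
  have surj: "\<exists>f. g = T f" for g using \<open>bij T\<close> by (metis bij_pointE)
  have bl: "bounded_linear T"
    by (rule positive_blinfun_operator_bounded[OF assms(1)]) (use le[of 0] T0 in simp)
  then obtain K where K: "K > 0" "\<And>f. norm (T f) \<le> norm f * K"
    using bounded_linear.pos_bounded by blast
  have "\<forall>\<epsilon>>0. \<exists>f\<in>T -` D. norm f < \<epsilon>"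
  proof (rule oc[unfolded dual_order_continuous_def, THEN spec, THEN mp], intro conjI ballI allI impI)
    show "T -` D \<noteq> {}"
    proof -
      obtain g where "g \<in> D" using D(1) by blast
      moreover obtain f where "g = T f" using surj[of g] by (elim exE)
      ultimately show ?thesis by auto
    qed
    show "\<exists>h\<in>T -` D. dle h f \<and> dle h g" if fg: "f \<in> T -` D" "g \<in> T -` D" for f g
    proof -
      obtain h where h: "h \<in> D" "dle h (T f)" "dle h (T g)" 
        using bspec[OF bspec[OF D(2), of "T f"], of "T g"] fg by auto
      obtain h' where h': "h = T h'" using surj[of h] by (elim exE)
      have "dle h' f" "dle h' g" using h h' le[of h' f] le[of h' g] by simp_all
      moreover have "h' \<in> T -` D" using h h' by simp
      ultimately show ?thesis by blast
    qed
    show "dle 0 f" if "f \<in> T -` D" for f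
      using that D(3) le[of 0 f] T0 by simp
    show "dle h 0" if h: "\<forall>f\<in>T -` D. dle h f" for h
    proof -
      have "dle (T h) g" if "g \<in> D" for g
      proof -
        obtain f where "g = T f" using surj[of g] by (elim exE)
        with h that le[of h f] show ?thesis by simp
      qed
      then have "dle (T h) 0" using D(4) by blast
      then show ?thesis using le[of h 0] T0 by simp
    qed
  qed
  then obtain f where f: "T f \<in> D" "norm f < \<epsilon> / K"
    using \<epsilon> K by (metis divide_pos_pos vimageE)
  have "norm (T f) \<le> norm f * K" by (rule K)
  also have "\<dots> < \<epsilon>" using f(2) K(1) by (simp add: pos_less_divide_eq)
  finally show "\<exists>f\<in>D. norm f < \<epsilon>" using f by blast
qed

text \<open>The functional is a plain function, so that one slot of a form with the others frozen
  can be inserted directly. \<open>Blinfun p\<close> is the intended functional only for bounded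
  linear \<open>p\<close>.\<close>

definition lift_slot ::
  "(('a::real_normed_vector \<Rightarrow>\<^sub>L real) \<Rightarrow> ('b::real_normed_vector \<Rightarrow>\<^sub>L real)) \<Rightarrow> ('a \<Rightarrow> real) \<Rightarrow> 'b \<Rightarrow> real"
  where "lift_slot T p y = blinfun_apply (T (Blinfun p)) y"

lemma Blinfun_lincomb:
  assumes "bounded_linear p" "bounded_linear q"
  shows "Blinfun (\<lambda>v. a * p v + b * q v) = a *\<^sub>R Blinfun p + b *\<^sub>R Blinfun (q :: _ \<Rightarrow> real)"
proof (rule blinfun_eqI)
  have "bounded_linear (\<lambda>v. a * p v + b * q v)"
    by (intro bounded_linear_add bounded_linear_const_mult assms)
  then show "blinfun_apply (Blinfun (\<lambda>v. a * p v + b * q v)) i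
      = blinfun_apply (a *\<^sub>R Blinfun p + b *\<^sub>R Blinfun q) i" for i
    by (simp add: bounded_linear_Blinfun_apply assms blinfun.bilinear_simps)
qed

lemma lift_slot_lincomb:
  assumes "linear T" "bounded_linear p" "bounded_linear q"
  shows "lift_slot T (\<lambda>v. a * p v + b * q v) y = a * lift_slot T p y + b * lift_slot T q y"
  by (simp add: lift_slot_def Blinfun_lincomb assms linear_add[OF assms(1)] linear_scale[OF assms(1)]
      blinfun.bilinear_simps)

lemma bounded_linear_lift_slot: "bounded_linear (lift_slot T p)"
  unfolding lift_slot_def by (rule blinfun.bounded_linear_right)

lemma lift_slot_inverse:
  assumes "\<And>f. S (T f) = f" "bounded_linear p"
  shows "lift_slot S (lift_slot T p) = p"
proof
  have "Blinfun (lift_slot T p) = T (Blinfun p)"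
    unfolding lift_slot_def by (rule blinfun_apply_inverse)
  then show "lift_slot S (lift_slot T p) x = p x" for x
    by (simp add: lift_slot_def[of S] assms bounded_linear_Blinfun_apply)
qed

lemma lift_slot_nonneg:
  assumes "\<And>f. dle 0 f \<Longrightarrow> dle 0 (T f)" "bounded_linear p" "\<And>v. 0 \<le> v \<Longrightarrow> 0 \<le> p v" "0 \<le> y"
  shows "0 \<le> lift_slot T p y"
proof -
  have "dle 0 (Blinfun p)" using assms by (simp add: dle_def bounded_linear_Blinfun_apply)
  from assms(1)[OF this] assms(4) show ?thesis by (simp add: dle_def lift_slot_def)
qed

lemma lift_slot_bound:
  assumes "bounded_linear T" "linear p" "\<And>v. \<bar>p v\<bar> \<le> c * norm v" "0 \<le> c"
  shows "\<bar>lift_slot T p y\<bar> \<le> onorm T * c * norm y"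
proof -
  have p: "bounded_linear p"
    by (rule bounded_linear_intro[where K = c])
       (use assms in \<open>auto simp: linear_add linear_scale mult.commute\<close>)
  have "norm (Blinfun p) \<le> c"
    using assms by (intro norm_blinfun_bound) (auto simp: bounded_linear_Blinfun_apply p)
  then have "norm (T (Blinfun p)) \<le> onorm T * c"
    using onorm[OF assms(1), of "Blinfun p"] onorm_pos_le[OF assms(1)]
    by (meson mult_left_mono order_trans)
  then have "norm (T (Blinfun p)) * norm y \<le> onorm T * c * norm y"
    by (rule mult_right_mono) simp
  then show ?thesis
    using norm_blinfun[of "T (Blinfun p)" y] by (simp add: lift_slot_def)
qed

lemma lift_slot_eq_ev:
  fixes T :: "('a::banach_lattice \<Rightarrow>\<^sub>L real) \<Rightarrow> ('b::banach_lattice \<Rightarrow>\<^sub>L real)"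
  assumes "linear T" "\<And>f. dle 0 f \<Longrightarrow> dle 0 (T f)" "0 \<le> y"
  shows "\<exists>\<phi>\<ge>0. \<forall>f. ev \<phi> f = lift_slot T (ev f) y"
proof -
  let ?p = "\<lambda>f. ev (Dual (T (functional f))) y"
  have "linear (\<lambda>f. ev f y :: real)" by (rule linearI) auto
  from linear_compose[OF linear_Dual_comp[OF assms(1)] this] have lin: "linear ?p"
    by (simp add: o_def)
  have pos: "0 \<le> ?p f" if "0 \<le> f" for f
  proof -
    have "dle 0 (functional f)" using that by (simp add: dle_functional flip: zero_dual.rep_eq)
    from assms(2)[OF this] assms(3) show ?thesis by (simp add: dle_def ev.abs_eq)
  qed
  obtain \<phi> :: "'a dual dual" where "0 \<le> \<phi>" "\<And>f. ev \<phi> f = ?p f"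
    using positive_linear_imp_ev[OF lin pos] by metis
  moreover have "Blinfun (ev f) = functional f" for f :: "'a dual"
    unfolding ev.rep_eq by (rule blinfun_apply_inverse)
  ultimately show ?thesis
    by (auto simp: lift_slot_def ev.abs_eq)
qed

text \<open>With \<open>\<phi>\<close> and \<open>\<psi>\<close> representing evaluation of
  \<open>T\<close> at \<open>y\<close> and at \<open>z\<close>, the left side is
  \<open>ev \<psi> (adj R \<phi>)\<close> and the right side
  \<open>ev \<phi> (adj S \<psi>)\<close>, for \<open>R\<close> and \<open>S\<close> formed from
  \<open>b\<close>.\<close>

lemma lift_slot_commute:
  fixes T :: "('a::banach_lattice \<Rightarrow>\<^sub>L real) \<Rightarrow> ('b::banach_lattice \<Rightarrow>\<^sub>L real)"
    and b :: "'a \<Rightarrow> 'a \<Rightarrow> real"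
  assumes T: "linear T" "\<And>f. dle 0 f \<Longrightarrow> dle 0 (T f)"
    and oc: "order_continuous_norm TYPE('a dual)"
    and b: "bounded_bilinear b" "\<And>u v. 0 \<le> u \<Longrightarrow> 0 \<le> v \<Longrightarrow> 0 \<le> b u v"
    and y: "0 \<le> y" "0 \<le> z"
  shows "lift_slot T (\<lambda>v. lift_slot T (\<lambda>u. b u v) y) z = lift_slot T (\<lambda>u. lift_slot T (\<lambda>v. b u v) z) y"
proof -
  define R where "R v = Dual (Blinfun (\<lambda>u. b u v))" for v
  define S where "S u = Dual (Blinfun (b u))" for u
  have evR: "ev (R v) = (\<lambda>u. b u v)" for v
    by (simp add: R_def ev.abs_eq bounded_linear_Blinfun_apply bounded_bilinear.bounded_linear_left[OF b(1)] fun_eq_iff)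
  have evS: "ev (S u) = b u" for u
    by (simp add: S_def ev.abs_eq bounded_linear_Blinfun_apply bounded_bilinear.bounded_linear_right[OF b(1)] fun_eq_iff)
  interpret positive_bilinear R S
  proof
    show "R (v + w) = R v + R w" "S (v + w) = S v + S w" for v w
      by (rule dual_eqI; simp add: evR evS bounded_bilinear.add_left[OF b(1)] bounded_bilinear.add_right[OF b(1)])+
    show "R (c *\<^sub>R v) = c *\<^sub>R R v" "S (c *\<^sub>R v) = c *\<^sub>R S v" for c v
      by (rule dual_eqI; simp add: evR evS bounded_bilinear.scaleR_left[OF b(1)] bounded_bilinear.scaleR_right[OF b(1)])+
    show "0 \<le> R v" if "0 \<le> v" for v
      using b(2) that by (simp add: dual_le_iff evR)
    show "ev (S u) v = ev (R v) u" for u v by (simp add: evR evS)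
  qed
  obtain \<phi> where \<phi>: "0 \<le> \<phi>" "\<And>f. ev \<phi> f = lift_slot T (ev f) y"
    using lift_slot_eq_ev[OF T y(1)] by blast
  obtain \<psi> where \<psi>: "0 \<le> \<psi>" "\<And>f. ev \<psi> f = lift_slot T (ev f) z"
    using lift_slot_eq_ev[OF T y(2)] by blast
  have "ev (adj R \<phi>) = (\<lambda>v. lift_slot T (\<lambda>u. b u v) y)"
    by (simp add: fun_eq_iff ev_adj_R \<phi> evR)
  moreover have "ev (adj S \<psi>) = (\<lambda>u. lift_slot T (b u) z)"
    by (simp add: fun_eq_iff ev_adj_S \<psi> evS)
  ultimately show ?thesis
    using arens_commute[OF oc oc \<phi>(1) \<psi>(1)] by (simp add: \<phi>(2) \<psi>(2))
qed

section \<open>Forms on mixed tuples\<close>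

text \<open>
  \<open>n\<close>-linear forms whose slots below \<open>k\<close> are fed from \<open>y\<close> and whose slots \<open>k, \<dots>, n - 1\<close> are fed from \<open>x\<close>;
  the last argument evaluates the functional-valued form.
\<close>

definition mixed :: "nat \<Rightarrow> nat \<Rightarrow>
    ((nat \<Rightarrow> 'f::banach_lattice) \<Rightarrow> (nat \<Rightarrow> 'e::banach_lattice) \<Rightarrow> 'g::banach_lattice \<Rightarrow> real) \<Rightarrow> bool" where
  "mixed n k m \<longleftrightarrow>
     (\<forall>y y' x x'. (\<forall>i<k. y i = y' i) \<longrightarrow> (\<forall>i. k \<le> i \<and> i < n \<longrightarrow> x i = x' i) \<longrightarrow> m y x = m y' x')
     \<and> (\<forall>y x g i. i < k \<longrightarrow> linear (\<lambda>w. m (y(i := w)) x g))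
     \<and> (\<forall>y x g i. k \<le> i \<and> i < n \<longrightarrow> linear (\<lambda>v. m y (x(i := v)) g))
     \<and> (\<forall>y x. linear (m y x))
     \<and> (\<exists>C\<ge>0. \<forall>y x g. \<bar>m y x g\<bar> \<le> C * ((\<Prod>i<k. norm (y i)) * (\<Prod>i\<in>{k..<n}. norm (x i)) * norm g))"

lemma mixedD:
  assumes "mixed n k m"
  shows mixed_cong: "\<And>y y' x x'. (\<And>i. i < k \<Longrightarrow> y i = y' i) \<Longrightarrow> (\<And>i. k \<le> i \<Longrightarrow> i < n \<Longrightarrow> x i = x' i) \<Longrightarrow> m y x = m y' x'"
    and mixed_linear_fst: "\<And>y x g i. i < k \<Longrightarrow> linear (\<lambda>w. m (y(i := w)) x g)"
    and mixed_linear_snd: "\<And>y x g i. k \<le> i \<Longrightarrow> i < n \<Longrightarrow> linear (\<lambda>v. m y (x(i := v)) g)"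
    and mixed_linear: "\<And>y x. linear (m y x)"
    and mixed_bound: "\<exists>C\<ge>0. \<forall>y x g. \<bar>m y x g\<bar> \<le> C * ((\<Prod>i<k. norm (y i)) * (\<Prod>i\<in>{k..<n}. norm (x i)) * norm g)"
  using assms unfolding mixed_def by blast+

lemma prod_norm_fun_upd:
  assumes "finite I" "i \<in> I"
  shows "(\<Prod>j\<in>I. norm ((x(i := v)) j)) = norm v * (\<Prod>j\<in>I - {i}. norm (x j))"
  by (subst prod.remove[OF assms]) (auto intro!: arg_cong2[where f = "(*)"] prod.cong)

lemma mixed_slot_bounded_linear:
  assumes m: "mixed n k m" and i: "k \<le> i" "i < n"
  shows "bounded_linear (\<lambda>v. m y (x(i := v)) g)"
proof -
  obtain C where C: "\<And>y x g. \<bar>m y x g\<bar> \<le> C * ((\<Prod>i<k. norm (y i)) * (\<Prod>i\<in>{k..<n}. norm (x i)) * norm g)"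
    using mixed_bound[OF m] by blast
  have lin: "linear (\<lambda>v. m y (x(i := v)) g)" by (rule mixed_linear_snd[OF m i])
  show ?thesis
  proof (rule bounded_linear_intro)
    show "m y (x(i := v + w)) g = m y (x(i := v)) g + m y (x(i := w)) g" for v w
      by (rule linear_add[OF lin])
    show "m y (x(i := r *\<^sub>R v)) g = r *\<^sub>R m y (x(i := v)) g" for r v
      by (rule linear_scale[OF lin])
    show "norm (m y (x(i := v)) g)
        \<le> norm v * (C * ((\<Prod>i<k. norm (y i)) * (\<Prod>j\<in>{k..<n} - {i}. norm (x j)) * norm g))" for v
      using C[of y "x(i := v)" g] i by (simp add: prod_norm_fun_upd mult_ac del: fun_upd_apply)
  qed
qed

lemma mixed_bounded_linear:
  assumes m: "mixed n k m"
  shows "bounded_linear (m y x)"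
proof -
  obtain C where C: "\<And>y x g. \<bar>m y x g\<bar> \<le> C * ((\<Prod>i<k. norm (y i)) * (\<Prod>i\<in>{k..<n}. norm (x i)) * norm g)"
    using mixed_bound[OF m] by blast
  show ?thesis
    by (rule bounded_linear_intro[where K = "C * ((\<Prod>i<k. norm (y i)) * (\<Prod>i\<in>{k..<n}. norm (x i)))"])
       (use C[of y x] in \<open>auto simp: linear_add[OF mixed_linear[OF m]] linear_scale[OF mixed_linear[OF m]] mult_ac\<close>)
qed

lemma mixed_slots_bounded_bilinear:
  assumes m: "mixed n k m" and ij: "k \<le> i" "i < n" "k \<le> j" "j < n" "i \<noteq> j"
  shows "bounded_bilinear (\<lambda>u v. m y (x(i := u, j := v)) g)"
proof -
  obtain C where C: "\<And>y x g. \<bar>m y x g\<bar> \<le> C * ((\<Prod>i<k. norm (y i)) * (\<Prod>i\<in>{k..<n}. norm (x i)) * norm g)"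
    using mixed_bound[OF m] by blast
  have swap: "x(i := u, j := v) = x(j := v, i := u)" for u v
    using ij(5) by (rule fun_upd_twist)
  have lin1: "linear (\<lambda>u. m y (x(i := u, j := v)) g)" for v
    unfolding swap by (rule mixed_linear_snd[OF m ij(1,2)])
  have lin2: "linear (\<lambda>v. m y (x(i := u, j := v)) g)" for u
    by (rule mixed_linear_snd[OF m ij(3,4)])
  show ?thesis
  proof
    show "m y (x(i := u + u', j := v)) g = m y (x(i := u, j := v)) g + m y (x(i := u', j := v)) g" for u u' v
      by (rule linear_add[OF lin1])
    show "m y (x(i := u, j := v + v')) g = m y (x(i := u, j := v)) g + m y (x(i := u, j := v')) g" for u v v'
      by (rule linear_add[OF lin2])
    show "m y (x(i := r *\<^sub>R u, j := v)) g = r *\<^sub>R m y (x(i := u, j := v)) g" for r u v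
      by (rule linear_scale[OF lin1])
    show "m y (x(i := u, j := r *\<^sub>R v)) g = r *\<^sub>R m y (x(i := u, j := v)) g" for r u v
      by (rule linear_scale[OF lin2])
    show "\<exists>K. \<forall>u v. norm (m y (x(i := u, j := v)) g) \<le> norm u * norm v * K"
    proof (intro exI allI)
      fix u v
      let ?P = "\<Prod>l\<in>{k..<n} - {j} - {i}. norm (x l)"
      have "(\<Prod>l\<in>{k..<n}. norm ((x(i := u, j := v)) l)) = norm v * (norm u * ?P)"
        using ij by (simp add: prod_norm_fun_upd del: fun_upd_apply)
      then show "norm (m y (x(i := u, j := v)) g) \<le> norm u * norm v * (C * ((\<Prod>i<k. norm (y i)) * ?P * norm g))"
        using C[of y "x(i := u, j := v)" g] by (simp add: mult_ac del: fun_upd_apply)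
    qed
  qed
qed

definition mixed_step ::
  "(('e \<Rightarrow>\<^sub>L real) \<Rightarrow> ('f \<Rightarrow>\<^sub>L real)) \<Rightarrow> nat \<Rightarrow>
    ((nat \<Rightarrow> 'f::banach_lattice) \<Rightarrow> (nat \<Rightarrow> 'e::banach_lattice) \<Rightarrow> 'g::banach_lattice \<Rightarrow> real) \<Rightarrow>
    (nat \<Rightarrow> 'f) \<Rightarrow> (nat \<Rightarrow> 'e) \<Rightarrow> 'g \<Rightarrow> real" where
  "mixed_step T k m y x g = lift_slot T (\<lambda>v. m y (x(k := v)) g) (y k)"

lemma mixed_mixed_step:
  fixes m :: "(nat \<Rightarrow> 'f::banach_lattice) \<Rightarrow> (nat \<Rightarrow> 'e::banach_lattice) \<Rightarrow> 'g::banach_lattice \<Rightarrow> real"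
  assumes T: "bounded_linear T" and k: "k < n" and m: "mixed n k m"
  shows "mixed n (Suc k) (mixed_step T k m)"
proof -
  have linT: "linear T" using T by (rule bounded_linear.linear)
  have bl: "bounded_linear (\<lambda>v. m y (x(k := v)) g)" for y x g
    by (rule mixed_slot_bounded_linear[OF m]) (use k in auto)
  \<comment> \<open>Letting \<open>Y\<close>, \<open>X\<close> and \<open>G\<close> depend on
    \<open>w\<close> covers linearity in the other slots of either tuple and in the last argument at
    once.\<close>
  have linear_lift: "linear (\<lambda>w. lift_slot T (\<lambda>v. m (Y w) ((X w)(k := v)) (G w)) y)"
    if "\<And>v. linear (\<lambda>w. m (Y w) ((X w)(k := v)) (G w))"
    for Y :: "'z::real_vector \<Rightarrow> nat \<Rightarrow> 'f" and X :: "'z \<Rightarrow> nat \<Rightarrow> 'e" and G :: "'z \<Rightarrow> 'g" and y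
  proof (rule linearI)
    fix w w' :: 'z and r :: real
    have "(\<lambda>v. m (Y (w + w')) ((X (w + w'))(k := v)) (G (w + w')))
        = (\<lambda>v. 1 * m (Y w) ((X w)(k := v)) (G w) + 1 * m (Y w') ((X w')(k := v)) (G w'))"
      by (simp add: linear_add[OF that])
    then show "lift_slot T (\<lambda>v. m (Y (w + w')) ((X (w + w'))(k := v)) (G (w + w'))) y
        = lift_slot T (\<lambda>v. m (Y w) ((X w)(k := v)) (G w)) y + lift_slot T (\<lambda>v. m (Y w') ((X w')(k := v)) (G w')) y"
      by (simp only: lift_slot_lincomb[OF linT bl bl])
    have "(\<lambda>v. m (Y (r *\<^sub>R w)) ((X (r *\<^sub>R w))(k := v)) (G (r *\<^sub>R w)))
        = (\<lambda>v. r * m (Y w) ((X w)(k := v)) (G w) + 0 * m (Y w) ((X w)(k := v)) (G w))"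
      by (simp add: linear_scale[OF that])
    then show "lift_slot T (\<lambda>v. m (Y (r *\<^sub>R w)) ((X (r *\<^sub>R w))(k := v)) (G (r *\<^sub>R w))) y
        = r *\<^sub>R lift_slot T (\<lambda>v. m (Y w) ((X w)(k := v)) (G w)) y"
      by (simp only: lift_slot_lincomb[OF linT bl bl]) simp
  qed
  show ?thesis
    unfolding mixed_def
  proof (intro conjI allI impI)
    fix y y' :: "nat \<Rightarrow> 'f" and x x' :: "nat \<Rightarrow> 'e"
    assume *: "\<forall>i<Suc k. y i = y' i" "\<forall>i. Suc k \<le> i \<and> i < n \<longrightarrow> x i = x' i"
    have "m y (x(k := v)) = m y' (x'(k := v))" for v
      using * by (intro mixed_cong[OF m]) auto
    then show "mixed_step T k m y x = mixed_step T k m y' x'"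
      using * by (simp add: mixed_step_def fun_eq_iff)
  next
    fix y :: "nat \<Rightarrow> 'f" and x :: "nat \<Rightarrow> 'e" and g :: 'g and i
    assume i: "i < Suc k"
    show "linear (\<lambda>w. mixed_step T k m (y(i := w)) x g)"
    proof (cases "i = k")
      case True
      have "mixed_step T k m (y(i := w)) x g = lift_slot T (\<lambda>v. m y (x(k := v)) g) w" for w
      proof -
        have "m (y(i := w)) (x(k := v)) = m y (x(k := v))" for v
          using True by (intro mixed_cong[OF m]) auto
        then show ?thesis using True by (simp add: mixed_step_def)
      qed
      then show ?thesis
        using bounded_linear.linear[OF bounded_linear_lift_slot] by simp
    next
      case False
      then have "mixed_step T k m (y(i := w)) x g = lift_slot T (\<lambda>v. m (y(i := w)) (x(k := v)) g) (y k)" for w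
        by (simp add: mixed_step_def)
      moreover have "linear (\<lambda>w. lift_slot T (\<lambda>v. m (y(i := w)) (x(k := v)) g) (y k))"
        using i False by (intro linear_lift mixed_linear_fst[OF m]) auto
      ultimately show ?thesis by simp
    qed
  next
    fix y :: "nat \<Rightarrow> 'f" and x :: "nat \<Rightarrow> 'e" and g :: 'g and i
    assume i: "Suc k \<le> i \<and> i < n"
    have "linear (\<lambda>w. m y (x(i := w, k := v)) g)" for v
    proof -
      have "x(i := w, k := v) = x(k := v, i := w)" for w using i by (intro fun_upd_twist) auto
      then show ?thesis using mixed_linear_snd[OF m, of i y "x(k := v)" g] i by simp
    qed
    then show "linear (\<lambda>v. mixed_step T k m y (x(i := v)) g)"
      unfolding mixed_step_def by (rule linear_lift)
  next
    fix y :: "nat \<Rightarrow> 'f" and x :: "nat \<Rightarrow> 'e"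
    show "linear (mixed_step T k m y x)"
      using linear_lift[of "\<lambda>g. y" "\<lambda>g. x" "\<lambda>g. g" "y k", OF mixed_linear[OF m]]
      unfolding mixed_step_def .
  next
    obtain C where C: "C \<ge> 0" "\<And>y x g. \<bar>m y x g\<bar> \<le> C * ((\<Prod>i<k. norm (y i)) * (\<Prod>i\<in>{k..<n}. norm (x i)) * norm g)"
      using mixed_bound[OF m] by blast
    show "\<exists>C\<ge>0. \<forall>y x g. \<bar>mixed_step T k m y x g\<bar>
        \<le> C * ((\<Prod>i<Suc k. norm (y i)) * (\<Prod>i\<in>{Suc k..<n}. norm (x i)) * norm g)"
    proof (intro exI conjI allI)
      show "0 \<le> onorm T * C" using C(1) onorm_pos_le[OF T] by simp
      fix y :: "nat \<Rightarrow> 'f" and x :: "nat \<Rightarrow> 'e" and g :: 'g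
      let ?c = "C * ((\<Prod>i<k. norm (y i)) * (\<Prod>i\<in>{Suc k..<n}. norm (x i)) * norm g)"
      have set: "{k..<n} - {k} = {Suc k..<n}" by auto
      have "\<bar>lift_slot T (\<lambda>v. m y (x(k := v)) g) (y k)\<bar> \<le> onorm T * ?c * norm (y k)"
      proof (rule lift_slot_bound[OF T])
        show "linear (\<lambda>v. m y (x(k := v)) g)" by (rule mixed_linear_snd[OF m]) (use k in auto)
        show "\<bar>m y (x(k := v)) g\<bar> \<le> ?c * norm v" for v
          using C(2)[of y "x(k := v)" g] k by (simp add: prod_norm_fun_upd set mult_ac del: fun_upd_apply)
        show "0 \<le> ?c" using C(1) by (simp add: prod_nonneg)
      qed
      then show "\<bar>mixed_step T k m y x g\<bar>
          \<le> onorm T * C * ((\<Prod>i<Suc k. norm (y i)) * (\<Prod>i\<in>{Suc k..<n}. norm (x i)) * norm g)"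
        by (simp add: mixed_step_def mult_ac)
    qed
  qed
qed

definition positive_mixed ::
  "((nat \<Rightarrow> 'f::banach_lattice) \<Rightarrow> (nat \<Rightarrow> 'e::banach_lattice) \<Rightarrow> 'g::banach_lattice \<Rightarrow> real) \<Rightarrow> bool" where
  "positive_mixed m \<longleftrightarrow> (\<forall>y x g. (\<forall>i. 0 \<le> y i) \<longrightarrow> (\<forall>i. 0 \<le> x i) \<longrightarrow> 0 \<le> g \<longrightarrow> 0 \<le> m y x g)"

lemma positive_mixed_step:
  fixes m :: "(nat \<Rightarrow> 'f::banach_lattice) \<Rightarrow> (nat \<Rightarrow> 'e::banach_lattice) \<Rightarrow> 'g::banach_lattice \<Rightarrow> real"
  assumes T: "\<And>f. dle 0 f \<Longrightarrow> dle 0 (T f)" and k: "k < n" and m: "mixed n k m" "positive_mixed m"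
  shows "positive_mixed (mixed_step T k m)"
  unfolding positive_mixed_def mixed_step_def
proof (intro allI impI)
  fix y :: "nat \<Rightarrow> 'f" and x :: "nat \<Rightarrow> 'e" and g :: 'g
  assume *: "\<forall>i. 0 \<le> y i" "\<forall>i. 0 \<le> x i" "0 \<le> g"
  show "0 \<le> lift_slot T (\<lambda>v. m y (x(k := v)) g) (y k)"
  proof (rule lift_slot_nonneg[OF T])
    show "bounded_linear (\<lambda>v. m y (x(k := v)) g)"
      by (rule mixed_slot_bounded_linear[OF m(1)]) (use k in auto)
    show "0 \<le> m y (x(k := v)) g" if "0 \<le> v" for v
      using m(2) * that by (simp add: positive_mixed_def)
  qed (use * in auto)
qed

lemma linear_eq_on_nonneg:
  fixes p q :: "'a::banach_lattice \<Rightarrow> 'b::real_vector"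
  assumes "linear p" "linear q" "\<And>v. 0 \<le> v \<Longrightarrow> p v = q v"
  shows "p v = q v"
proof -
  have "p v = p (pprt v) - p (pprt (- v))" "q v = q (pprt v) - q (pprt (- v))"
    by (metis assms(1) linear_diff pprt_diff_pprt, metis assms(2) linear_diff pprt_diff_pprt)
  then show ?thesis by (simp add: assms(3))
qed

text \<open>As \<open>m\<close> is symmetric in the slots \<open>k\<close> and \<open>Suc k\<close>,
  exchanging the entries of \<open>y\<close> there amounts to exchanging the order in which
  \<open>T\<close> is applied to the two slots. This is where commutation is needed.\<close>

lemma mixed_step_swap:
  fixes m :: "(nat \<Rightarrow> 'f::banach_lattice) \<Rightarrow> (nat \<Rightarrow> 'e::banach_lattice) \<Rightarrow> 'g::banach_lattice \<Rightarrow> real"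
  assumes T: "linear T" "\<And>f. dle 0 f \<Longrightarrow> dle 0 (T f)"
    and oc: "order_continuous_norm TYPE('e dual)"
    and m: "mixed n k m" "positive_mixed m" and k: "Suc k < n"
    and sym: "\<And>u v. m y (x(k := u, Suc k := v)) g = m y (x(k := v, Suc k := u)) g"
    and pos: "\<And>i. 0 \<le> y i" "\<And>i. 0 \<le> x i" "0 \<le> g"
  shows "mixed_step T (Suc k) (mixed_step T k m) (y \<circ> Transposition.transpose k (Suc k)) x g
    = mixed_step T (Suc k) (mixed_step T k m) y x g"
proof -
  define b where "b u v = m y (x(k := u, Suc k := v)) g" for u v
  have upd: "x(Suc k := v, k := u) = x(k := u, Suc k := v)" for u v
    by (rule fun_upd_twist) simp
  have dep: "m (y \<circ> Transposition.transpose k (Suc k)) = m y"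
    by (rule ext, rule mixed_cong[OF m(1)]) (auto simp: Transposition.transpose_def)
  have "bounded_bilinear b"
    unfolding b_def by (rule mixed_slots_bounded_bilinear[OF m(1)]) (use k in auto)
  moreover have "0 \<le> b u v" if "0 \<le> u" "0 \<le> v" for u v
    using m(2) pos that by (simp add: positive_mixed_def b_def)
  ultimately have comm: "lift_slot T (\<lambda>v. lift_slot T (\<lambda>u. b u v) (y k)) (y (Suc k))
      = lift_slot T (\<lambda>u. lift_slot T (\<lambda>v. b u v) (y (Suc k))) (y k)"
    using lift_slot_commute[OF T oc] pos by blast
  have b_sym: "b u v = b v u" for u v unfolding b_def by (rule sym)
  have "mixed_step T (Suc k) (mixed_step T k m) (y \<circ> Transposition.transpose k (Suc k)) x g
      = lift_slot T (\<lambda>v. lift_slot T (\<lambda>u. b u v) (y (Suc k))) (y k)"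
    by (simp add: mixed_step_def dep upd b_def)
  also have "\<dots> = lift_slot T (\<lambda>v. lift_slot T (\<lambda>u. b v u) (y (Suc k))) (y k)"
    by (subst b_sym) (rule refl)
  also have "\<dots> = lift_slot T (\<lambda>v. lift_slot T (\<lambda>u. b u v) (y k)) (y (Suc k))"
    by (rule comm[symmetric])
  also have "\<dots> = mixed_step T (Suc k) (mixed_step T k m) y x g"
    by (simp add: mixed_step_def upd b_def)
  finally show ?thesis .
qed

section \<open>Transferring symmetric forms\<close>

lemma sym_nlinearD:
  assumes "sym_nlinear n A"
  shows sym_nlinear_cong: "\<And>x y. (\<And>i. i < n \<Longrightarrow> x i = y i) \<Longrightarrow> A x = A y"
    and sym_nlinear_linear: "\<And>x i. i < n \<Longrightarrow> linear (\<lambda>v. A (x(i := v)))"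
    and sym_nlinear_permute: "\<And>x \<sigma>. \<sigma> permutes {..<n} \<Longrightarrow> A (x \<circ> \<sigma>) = A x"
    and sym_nlinear_bound: "\<exists>C\<ge>0. \<forall>x. norm (A x) \<le> C * (\<Prod>i<n. norm (x i))"
proof -
  obtain C where C: "\<And>x. norm (A x) \<le> C * (\<Prod>i<n. norm (x i))"
    using assms unfolding sym_nlinear_def by blast
  have "norm (A x) \<le> \<bar>C\<bar> * (\<Prod>i<n. norm (x i))" for x
    using C[of x] by (rule order_trans) (intro mult_right_mono prod_nonneg, auto)
  then show "\<exists>C\<ge>0. \<forall>x. norm (A x) \<le> C * (\<Prod>i<n. norm (x i))"
    by (intro exI[of _ "\<bar>C\<bar>"]) auto
qed (use assms in \<open>auto simp: sym_nlinear_def\<close>)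

lemma mixed_sym_nlinear:
  assumes A: "sym_nlinear n A"
  shows "mixed n 0 (\<lambda>(y :: nat \<Rightarrow> 'f::banach_lattice) x. blinfun_apply (A x))"
proof -
  obtain C where C: "C \<ge> 0" "\<And>x. norm (A x) \<le> C * (\<Prod>i<n. norm (x i))"
    using sym_nlinear_bound[OF A] by blast
  show ?thesis
    unfolding mixed_def
  proof (intro conjI allI impI)
    fix x x' :: "nat \<Rightarrow> 'a" assume "\<forall>i. 0 \<le> i \<and> i < n \<longrightarrow> x i = x' i"
    then have "A x = A x'" by (intro sym_nlinear_cong[OF A]) auto
    then show "blinfun_apply (A x) = blinfun_apply (A x')" by simp
  next
    fix x :: "nat \<Rightarrow> 'a" and g i assume "0 \<le> i \<and> i < n"
    then have lin: "linear (\<lambda>v. A (x(i := v)))" by (intro sym_nlinear_linear[OF A]) auto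
    show "linear (\<lambda>v. blinfun_apply (A (x(i := v))) g)"
      by (rule linearI) (simp_all add: linear_add[OF lin] linear_scale[OF lin] blinfun.bilinear_simps)
  next
    show "linear (blinfun_apply (A x))" for x
      by (intro bounded_linear.linear blinfun.bounded_linear_right)
  next
    show "\<exists>C\<ge>0. \<forall>(y :: nat \<Rightarrow> 'f) x g. \<bar>blinfun_apply (A x) g\<bar>
      \<le> C * ((\<Prod>i<0. norm (y i)) * (\<Prod>i = 0..<n. norm (x i)) * norm g)"
    proof (intro exI conjI allI)
      fix y :: "nat \<Rightarrow> 'f" and x g
      have "\<bar>blinfun_apply (A x) g\<bar> \<le> norm (A x) * norm g"
        using norm_blinfun[of "A x" g] by simp
      also have "\<dots> \<le> C * (\<Prod>i<n. norm (x i)) * norm g"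
        by (intro mult_right_mono C) auto
      finally show "\<bar>blinfun_apply (A x) g\<bar> \<le> C * ((\<Prod>i<0. norm (y i)) * (\<Prod>i = 0..<n. norm (x i)) * norm g)"
        by (simp add: mult_ac atLeast0LessThan)
    qed (rule C)
  qed auto
qed

section \<open>The iterated transfer and its symmetry\<close>

primrec mixed_seq ::
  "(('e::banach_lattice \<Rightarrow>\<^sub>L real) \<Rightarrow> ('f::banach_lattice \<Rightarrow>\<^sub>L real)) \<Rightarrow>
    ((nat \<Rightarrow> 'e) \<Rightarrow> ('g::banach_lattice \<Rightarrow>\<^sub>L real)) \<Rightarrow> nat \<Rightarrow> (nat \<Rightarrow> 'f) \<Rightarrow> (nat \<Rightarrow> 'e) \<Rightarrow> 'g \<Rightarrow> real" where
  "mixed_seq T A 0 = (\<lambda>y x. blinfun_apply (A x))"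
| "mixed_seq T A (Suc k) = mixed_step T k (mixed_seq T A k)"

text \<open>After \<open>n\<close> steps no slot reads the second tuple any more, so the zero tuple
  is an arbitrary filler.\<close>

definition transfer_form ::
  "(('e::banach_lattice \<Rightarrow>\<^sub>L real) \<Rightarrow> ('f::banach_lattice \<Rightarrow>\<^sub>L real)) \<Rightarrow> nat \<Rightarrow>
    ((nat \<Rightarrow> 'e) \<Rightarrow> ('g::banach_lattice \<Rightarrow>\<^sub>L real)) \<Rightarrow> (nat \<Rightarrow> 'f) \<Rightarrow> ('g \<Rightarrow>\<^sub>L real)" where
  "transfer_form T n A y = Blinfun (mixed_seq T A n y (\<lambda>_. 0))"

definition positive_form :: "nat \<Rightarrow> ((nat \<Rightarrow> 'e::banach_lattice) \<Rightarrow> ('g::banach_lattice \<Rightarrow>\<^sub>L real)) \<Rightarrow> bool" where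
  "positive_form n A \<longleftrightarrow> sym_nlinear n A \<and> (\<forall>x. (\<forall>i<n. 0 \<le> x i) \<longrightarrow> dle 0 (A x))"

lemma mixed_mixed_seq:
  assumes "bounded_linear T" "sym_nlinear n A"
  shows "k \<le> n \<Longrightarrow> mixed n k (mixed_seq T A k)"
  by (induction k) (auto intro: mixed_sym_nlinear mixed_mixed_step assms)

lemma transfer_form_apply:
  assumes "bounded_linear T" "sym_nlinear n A"
  shows "blinfun_apply (transfer_form T n A y) g = mixed_seq T A n y x g"
proof -
  have m: "mixed n n (mixed_seq T A n)" by (rule mixed_mixed_seq[OF assms]) simp
  have "mixed_seq T A n y (\<lambda>_. 0) = mixed_seq T A n y x"
    by (rule mixed_cong[OF m]) auto
  then show ?thesis
    by (simp add: transfer_form_def bounded_linear_Blinfun_apply mixed_bounded_linear[OF m])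
qed

lemma positive_mixed_seq:
  assumes T: "bounded_linear T" "\<And>f. dle 0 f \<Longrightarrow> dle 0 (T f)" and A: "positive_form n A"
  shows "k \<le> n \<Longrightarrow> positive_mixed (mixed_seq T A k)"
proof (induction k)
  case 0
  show ?case using A by (auto simp: positive_form_def positive_mixed_def dle_def)
next
  case (Suc k)
  then show ?case
    using A by (auto intro!: positive_mixed_step[where n = n] T mixed_mixed_seq simp: positive_form_def)
qed

text \<open>Updating the slot being transferred commutes with a transposition of two later slots, so
  slots not yet transferred remain interchangeable.\<close>

lemma mixed_seq_swap_snd:
  assumes A: "sym_nlinear n A"
  shows "k \<le> i \<Longrightarrow> i < n \<Longrightarrow> k \<le> j \<Longrightarrow> j < n \<Longrightarrow>
    mixed_seq T A k y (x \<circ> Transposition.transpose i j) g = mixed_seq T A k y x g"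
proof (induction k arbitrary: y x)
  case 0
  then have "A (x \<circ> Transposition.transpose i j) = A x"
    by (intro sym_nlinear_permute[OF A] permutes_swap_id) auto
  then show ?case by (simp add: o_def)
next
  case (Suc k)
  have upd: "(x \<circ> Transposition.transpose i j)(k := v) = x(k := v) \<circ> Transposition.transpose i j" for v
    using Suc.prems by (auto simp: fun_eq_iff Transposition.transpose_def)
  have "mixed_seq T A k y ((x \<circ> Transposition.transpose i j)(k := v)) g = mixed_seq T A k y (x(k := v)) g" for v
    unfolding upd by (rule Suc.IH) (use Suc.prems in auto)
  then show ?case by (simp only: mixed_seq.simps mixed_step_def)
qed

text \<open>In the induction step, a transposition within the earlier slots is settled by the
  hypothesis, that of the last two slots by commutation, and any other one involving the last slot
  by conjugation. The tuples are nonnegative because commutation was obtained for positive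
  functionals.\<close>

lemma mixed_seq_swap_fst:
  fixes T :: "('e::banach_lattice \<Rightarrow>\<^sub>L real) \<Rightarrow> ('f::banach_lattice \<Rightarrow>\<^sub>L real)"
  assumes T: "bounded_linear T" "\<And>f. dle 0 f \<Longrightarrow> dle 0 (T f)"
    and oc: "order_continuous_norm TYPE('e dual)"
    and A: "positive_form n A"
  shows "k \<le> n \<Longrightarrow> i < k \<Longrightarrow> j < k \<Longrightarrow> (\<And>l. 0 \<le> y l) \<Longrightarrow> (\<And>l. 0 \<le> x l) \<Longrightarrow> 0 \<le> g \<Longrightarrow>
    mixed_seq T A k (y \<circ> Transposition.transpose i j) x g = mixed_seq T A k y x g"
proof (induction k arbitrary: i j x y)
  case 0
  then show ?case by simp
next
  case (Suc k)
  have linT: "linear T" using T(1) by (rule bounded_linear.linear)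
  have symA: "sym_nlinear n A" using A by (simp add: positive_form_def)
  have inner: "mixed_seq T A (Suc k) (y \<circ> Transposition.transpose i j) x g = mixed_seq T A (Suc k) y x g"
    if ij: "i < k" "j < k" and y: "\<And>l. 0 \<le> y l" for i j and y :: "nat \<Rightarrow> 'f"
  proof -
    have m: "mixed n k (mixed_seq T A k)" using Suc.prems by (intro mixed_mixed_seq T symA) simp
    \<comment> \<open>The functionals in slot \<open>k\<close> must agree at every \<open>v\<close>,
      whereas the induction hypothesis speaks of nonnegative entries; linearity in \<open>v\<close>
      bridges the gap.\<close>
    have "mixed_seq T A k (y \<circ> Transposition.transpose i j) (x(k := v)) g = mixed_seq T A k y (x(k := v)) g" for v
    proof (rule linear_eq_on_nonneg[where p = "\<lambda>v. mixed_seq T A k (y \<circ> Transposition.transpose i j) (x(k := v)) g"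
            and q = "\<lambda>v. mixed_seq T A k y (x(k := v)) g"])
      show "linear (\<lambda>v. mixed_seq T A k (y \<circ> Transposition.transpose i j) (x(k := v)) g)"
        "linear (\<lambda>v. mixed_seq T A k y (x(k := v)) g)"
        by (rule mixed_linear_snd[OF m]; use Suc.prems in simp)+
      show "mixed_seq T A k (y \<circ> Transposition.transpose i j) (x(k := v)) g = mixed_seq T A k y (x(k := v)) g"
        if "0 \<le> v" for v
        using Suc.prems ij y that by (intro Suc.IH) auto
    qed
    moreover have "(y \<circ> Transposition.transpose i j) k = y k"
      using ij by (simp add: Transposition.transpose_def)
    ultimately show ?thesis by (simp only: mixed_seq.simps mixed_step_def)
  qed
  have adjacent: "mixed_seq T A (Suc k) (y \<circ> Transposition.transpose l k) x g = mixed_seq T A (Suc k) y x g"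
    if l: "Suc l = k" and y: "\<And>l. 0 \<le> y l" for l and y :: "nat \<Rightarrow> 'f"
  proof -
    have "mixed_seq T A l y (x(l := u, Suc l := v)) g = mixed_seq T A l y (x(l := v, Suc l := u)) g" for u v
    proof -
      have "x(l := u, Suc l := v) = x(l := v, Suc l := u) \<circ> Transposition.transpose l (Suc l)"
        by (auto simp: fun_eq_iff Transposition.transpose_def)
      then show ?thesis
        using mixed_seq_swap_snd[OF symA, of l l "Suc l" T y "x(l := v, Suc l := u)" g] l Suc.prems by simp
    qed
    then have "mixed_step T (Suc l) (mixed_step T l (mixed_seq T A l)) (y \<circ> Transposition.transpose l (Suc l)) x g
        = mixed_step T (Suc l) (mixed_step T l (mixed_seq T A l)) y x g"
      using l Suc.prems y
      by (intro mixed_step_swap[where n = n] linT T oc mixed_mixed_seq positive_mixed_seq[OF T A] symA) auto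
    then show ?thesis using l by auto
  qed
  have last: "mixed_seq T A (Suc k) (y \<circ> Transposition.transpose i k) x g = mixed_seq T A (Suc k) y x g"
    if i: "i < k" and y: "\<And>l. 0 \<le> y l" for i and y :: "nat \<Rightarrow> 'f"
  proof -
    obtain l where l: "Suc l = k" using i by (metis less_imp_Suc_add)
    show ?thesis
    proof (cases "i = l")
      case True
      then show ?thesis using adjacent[OF l] y by simp
    next
      case False
      let ?t = "Transposition.transpose i l"
      \<comment> \<open>Conjugating the transposition of \<open>l\<close> and \<open>k\<close> by
        that of \<open>i\<close> and \<open>l\<close>, which acts within the first \<open>k\<close>
        slots.\<close>
      have "y \<circ> Transposition.transpose i k = ((y \<circ> ?t) \<circ> Transposition.transpose l k) \<circ> ?t"
        using l i False by (auto simp: fun_eq_iff Transposition.transpose_def)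
      then have "mixed_seq T A (Suc k) (y \<circ> Transposition.transpose i k) x g
          = mixed_seq T A (Suc k) ((y \<circ> ?t) \<circ> Transposition.transpose l k) x g"
        using inner[of i l "(y \<circ> ?t) \<circ> Transposition.transpose l k"] l i False y by simp
      also have "\<dots> = mixed_seq T A (Suc k) (y \<circ> ?t) x g"
        using adjacent[OF l, of "y \<circ> ?t"] y by simp
      also have "\<dots> = mixed_seq T A (Suc k) y x g"
        using inner[of i l y] l i False y by simp
      finally show ?thesis .
    qed
  qed
  consider "i = j" | "i < k" "j < k" | "i < k" "j = k" | "i = k" "j < k"
    using Suc.prems by linarith
  then show ?case
  proof cases
    case 1
    then show ?thesis by simp
  next
    case 2
    then show ?thesis using inner Suc.prems by blast
  next
    case 3
    then show ?thesis using last Suc.prems by blast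
  next
    case 4
    then have "mixed_seq T A (Suc k) (y \<circ> Transposition.transpose j i) x g = mixed_seq T A (Suc k) y x g"
      using last[of j y] Suc.prems by blast
    then show ?thesis by (simp only: transpose_commute[of i j])
  qed
qed

text \<open>The cone generates the space, so the slots can be freed from the sign condition one at a
  time; \<open>j\<close> counts those already free.\<close>

lemma nlinear_eq_on_nonneg:
  fixes P Q :: "(nat \<Rightarrow> 'a::banach_lattice) \<Rightarrow> 'b::real_vector"
  assumes cong: "\<And>x y. (\<And>i. i < n \<Longrightarrow> x i = y i) \<Longrightarrow> P x = P y" "\<And>x y. (\<And>i. i < n \<Longrightarrow> x i = y i) \<Longrightarrow> Q x = Q y"
    and lin: "\<And>x i. i < n \<Longrightarrow> linear (\<lambda>v. P (x(i := v)))" "\<And>x i. i < n \<Longrightarrow> linear (\<lambda>v. Q (x(i := v)))"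
    and eq: "\<And>x. (\<And>i. 0 \<le> x i) \<Longrightarrow> P x = Q x"
  shows "P x = Q x"
proof -
  have *: "P x = Q x" if "j \<le> n" "\<And>i. j \<le> i \<Longrightarrow> 0 \<le> x i" for j x
    using that
  proof (induction j arbitrary: x)
    case 0
    then show ?case by (intro eq) simp
  next
    case (Suc j)
    have "P (x(j := v)) = Q (x(j := v))" for v
    proof (rule linear_eq_on_nonneg[of "\<lambda>v. P (x(j := v))" "\<lambda>v. Q (x(j := v))", OF lin])
      show "P (x(j := v)) = Q (x(j := v))" if "0 \<le> v" for v
        using Suc.prems that by (intro Suc.IH) auto
    qed (use Suc.prems in auto)
    from this[of "x j"] show ?case by simp
  qed
  let ?x = "\<lambda>i. if i < n then x i else 0"
  have "P x = P ?x" by (rule cong) simp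
  also have "\<dots> = Q ?x" by (rule *[of n]) auto
  also have "\<dots> = Q x" by (rule cong) simp
  finally show ?thesis .
qed

lemma positive_form_transfer:
  fixes T :: "('e::banach_lattice \<Rightarrow>\<^sub>L real) \<Rightarrow> ('f::banach_lattice \<Rightarrow>\<^sub>L real)"
    and A :: "(nat \<Rightarrow> 'e) \<Rightarrow> ('g::banach_lattice \<Rightarrow>\<^sub>L real)"
  assumes T: "bounded_linear T" "\<And>f. dle 0 f \<Longrightarrow> dle 0 (T f)"
    and oc: "order_continuous_norm TYPE('e dual)"
    and A: "positive_form n A"
  shows "positive_form n (transfer_form T n A)"
proof -
  let ?B = "transfer_form T n A"
  have symA: "sym_nlinear n A" using A by (simp add: positive_form_def)
  have m: "mixed n n (mixed_seq T A n)" by (rule mixed_mixed_seq[OF T(1) symA]) simp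
  have B: "blinfun_apply (?B y) g = mixed_seq T A n y (\<lambda>_. 0) g" for y g
    by (rule transfer_form_apply[OF T(1) symA])
  have cong: "?B x = ?B y" if "\<And>i. i < n \<Longrightarrow> x i = y i" for x y
  proof -
    have "mixed_seq T A n x (\<lambda>_. 0) = mixed_seq T A n y (\<lambda>_. 0)"
      by (rule mixed_cong[OF m]) (use that in auto)
    then show ?thesis by (simp add: transfer_form_def)
  qed
  have lin: "linear (\<lambda>v. ?B (x(i := v)))" if "i < n" for x i
  proof -
    have *: "linear (\<lambda>v. blinfun_apply (?B (x(i := v))) g)" for g
      unfolding B by (rule mixed_linear_fst[OF m that])
    show ?thesis
      by (intro linearI blinfun_eqI) (simp_all add: linear_add[OF *] linear_scale[OF *] blinfun.bilinear_simps)
  qed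
  \<comment> \<open>Symmetry is known for nonnegative tuples and nonnegative \<open>g\<close>;
    linearity in each slot and in \<open>g\<close> removes both restrictions.\<close>
  have swap: "?B (x \<circ> Transposition.transpose i j) = ?B x" if ij: "i < n" "j < n" for x i j
  proof (rule nlinear_eq_on_nonneg[where P = "\<lambda>x. ?B (x \<circ> Transposition.transpose i j)" and Q = ?B and n = n])
    let ?t = "Transposition.transpose i j"
    have t: "?t l < n" if "l < n" for l using ij that by (simp add: Transposition.transpose_def)
    show "?B (x \<circ> ?t) = ?B (y \<circ> ?t)" if "\<And>i. i < n \<Longrightarrow> x i = y i" for x y
      by (rule cong) (use that t in auto)
    show "linear (\<lambda>v. ?B (x(l := v) \<circ> ?t))" if "l < n" for x l
    proof -
      have "x(l := v) \<circ> ?t = (x \<circ> ?t)(?t l := v)" for v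
        by (auto simp: fun_eq_iff Transposition.transpose_def)
      then show ?thesis using lin[OF t[OF that]] by simp
    qed
    show "?B (x \<circ> ?t) = ?B x" if x: "\<And>i. 0 \<le> x i" for x
    proof (rule blinfun_eqI)
      fix g
      show "blinfun_apply (?B (x \<circ> ?t)) g = blinfun_apply (?B x) g"
      proof (rule linear_eq_on_nonneg[where p = "blinfun_apply (?B (x \<circ> ?t))" and q = "blinfun_apply (?B x)"])
        show "linear (blinfun_apply (?B (x \<circ> ?t)))" "linear (blinfun_apply (?B x))"
          by (intro bounded_linear.linear blinfun.bounded_linear_right)+
        show "blinfun_apply (?B (x \<circ> ?t)) g = blinfun_apply (?B x) g" if "0 \<le> g" for g
          unfolding B using ij x that by (intro mixed_seq_swap_fst[OF T oc A]) auto
      qed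
    qed
    show "?B x = ?B y" if "\<And>i. i < n \<Longrightarrow> x i = y i" for x y
      by (rule cong) (rule that)
    show "linear (\<lambda>v. ?B (x(l := v)))" if "l < n" for x l
      by (rule lin[OF that])
  qed
  have "\<forall>x. ?B (x \<circ> \<sigma>) = ?B x" if "\<sigma> permutes {..<n}" for \<sigma>
    using that
  proof (rule permutes_induct)
    show "\<forall>x. ?B (x \<circ> id) = ?B x" by simp
  next
    fix a b p assume "a \<in> {..<n}" "b \<in> {..<n}" "\<forall>x. ?B (x \<circ> p) = ?B x"
    then show "\<forall>x. ?B (x \<circ> (Transposition.transpose a b \<circ> p)) = ?B x"
      using swap[of a b] by (simp flip: comp_assoc)
  qed simp
  moreover have "\<exists>C. \<forall>x. norm (?B x) \<le> C * (\<Prod>i<n. norm (x i))"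
  proof -
    obtain C where C: "C \<ge> 0" "\<And>y x g. \<bar>mixed_seq T A n y x g\<bar>
        \<le> C * ((\<Prod>i<n. norm (y i)) * (\<Prod>i\<in>{n..<n}. norm (x i)) * norm g)"
      using mixed_bound[OF m] by blast
    have "norm (?B x) \<le> C * (\<Prod>i<n. norm (x i))" for x
    proof (rule norm_blinfun_bound)
      show "0 \<le> C * (\<Prod>i<n. norm (x i))" using C(1) by (simp add: prod_nonneg)
      show "norm (blinfun_apply (?B x) g) \<le> C * (\<Prod>i<n. norm (x i)) * norm g" for g
        using C(2)[of x "\<lambda>_. 0" g] by (simp add: B mult_ac)
    qed
    then show ?thesis by blast
  qed
  ultimately have "sym_nlinear n ?B"
    unfolding sym_nlinear_def using cong lin by blast
  moreover have "dle 0 (?B x)" if x: "\<forall>i<n. 0 \<le> x i" for x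
  proof -
    let ?x = "\<lambda>i. if i < n then x i else 0"
    have "?B x = ?B ?x" by (rule cong) simp
    moreover have "0 \<le> blinfun_apply (?B ?x) g" if "0 \<le> g" for g
    proof -
      have "positive_mixed (mixed_seq T A n)" by (rule positive_mixed_seq[OF T A order_refl])
      then show ?thesis unfolding B positive_mixed_def using x that by simp
    qed
    ultimately show ?thesis by (simp add: dle_def)
  qed
  ultimately show ?thesis by (simp add: positive_form_def)
qed

text \<open>
  Undoing the slots in the order in which they were transferred leaves a form on mixed tuples with
  transferred and original slots interchanged; reversing the tuples, which a symmetric form does not see,
  turns it into an intermediate stage of the transfer itself.
\<close>

lemma transfer_form_inverse:
  fixes T :: "('e::banach_lattice \<Rightarrow>\<^sub>L real) \<Rightarrow> ('f::banach_lattice \<Rightarrow>\<^sub>L real)"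
    and A :: "(nat \<Rightarrow> 'e) \<Rightarrow> ('g::banach_lattice \<Rightarrow>\<^sub>L real)"
  assumes T: "bounded_linear T" and S: "bounded_linear S" and ST: "\<And>f. S (T f) = f"
    and A: "sym_nlinear n A" and B: "sym_nlinear n (transfer_form T n A)"
  shows "transfer_form S n (transfer_form T n A) = A"
proof -
  let ?B = "transfer_form T n A"
  define \<rho> where "\<rho> i = (if i < n then n - 1 - i else i)" for i
  have \<rho>: "\<rho> permutes {..<n}"
  proof (rule bij_imp_permutes)
    show "bij_betw \<rho> {..<n} {..<n}"
      by (rule bij_betw_byWitness[where f' = \<rho>]) (auto simp: \<rho>_def)
  qed (simp add: \<rho>_def)
  \<comment> \<open>Slots are undone from 0 upwards, whereas the outermost \<open>T\<close> of a
    stage sits in its last slot. After the reversal, slot \<open>j\<close> becomes slot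
    \<open>n - Suc j\<close>, the one transferred last at stage \<open>n - j\<close>, so
    \<open>S\<close> meets \<open>T\<close> directly.\<close>
  have *: "mixed_seq S ?B j x y g = mixed_seq T A (n - j) (y \<circ> \<rho>) (x \<circ> \<rho>) g" if "j \<le> n" for j x y g
    using that
  proof (induction j arbitrary: x y)
    case 0
    have "?B y = ?B (y \<circ> \<rho>)" by (rule sym_nlinear_permute[OF B \<rho>, symmetric])
    then show ?case
      by (simp only: mixed_seq.simps diff_zero transfer_form_apply[OF T A, of "y \<circ> \<rho>" g "x \<circ> \<rho>"])
  next
    case (Suc j)
    define k where "k = n - Suc j"
    have k: "n - j = Suc k" "k < n" "\<rho> k = j" "\<rho> j = k"
      using Suc.prems by (auto simp: k_def \<rho>_def)
    have m: "mixed n k (mixed_seq T A k)" by (rule mixed_mixed_seq[OF T A]) (use k in simp)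
    define p where "p v = mixed_seq T A k (y \<circ> \<rho>) ((x \<circ> \<rho>)(k := v)) g" for v
    have p: "bounded_linear p"
      unfolding p_def by (rule mixed_slot_bounded_linear[OF m]) (use k in auto)
    have "mixed_seq S ?B j x (y(j := w)) g = lift_slot T p w" for w
    proof -
      have "mixed_seq S ?B j x (y(j := w)) g = mixed_seq T A (n - j) (y(j := w) \<circ> \<rho>) (x \<circ> \<rho>) g"
        by (rule Suc.IH) (use Suc.prems in simp)
      moreover have "mixed_seq T A k (y(j := w) \<circ> \<rho>) z = mixed_seq T A k (y \<circ> \<rho>) z" for z
        by (rule mixed_cong[OF m]) (use k in \<open>auto simp: \<rho>_def split: if_splits\<close>)
      moreover have "(y(j := w) \<circ> \<rho>) k = w" using k by simp
      ultimately show ?thesis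
        by (simp only: k(1) mixed_seq.simps mixed_step_def p_def[abs_def])
    qed
    then have "mixed_seq S ?B (Suc j) x y g = lift_slot S (lift_slot T p) (x j)"
      by (simp only: mixed_seq.simps mixed_step_def)
    also have "\<dots> = p (x j)" using lift_slot_inverse[of S T, OF ST p] by simp
    also have "\<dots> = mixed_seq T A k (y \<circ> \<rho>) (x \<circ> \<rho>) g"
    proof -
      have "(x \<circ> \<rho>)(k := x j) = x \<circ> \<rho>" using k by (auto simp: fun_eq_iff)
      then show ?thesis by (simp only: p_def)
    qed
    finally show ?case by (simp only: k_def)
  qed
  show ?thesis
  proof (intro ext blinfun_eqI)
    fix x g
    have "blinfun_apply (transfer_form S n ?B x) g = blinfun_apply (A (x \<circ> \<rho>)) g"
      using *[of n x "\<lambda>_. 0" g]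
      by (simp only: transfer_form_apply[OF S B, of x g "\<lambda>_. 0"] diff_self_eq_0 mixed_seq.simps order_refl)
    then show "blinfun_apply (transfer_form S n ?B x) g = blinfun_apply (A x) g"
      by (simp only: sym_nlinear_permute[OF A \<rho>])
  qed
qed

lemma sym_nlinear_lincomb:
  assumes A: "sym_nlinear n A" and B: "sym_nlinear n B"
  shows "sym_nlinear n (\<lambda>x. a *\<^sub>R A x + b *\<^sub>R B x)"
  unfolding sym_nlinear_def
proof (intro conjI allI impI)
  fix x y :: "nat \<Rightarrow> 'a" assume "\<forall>i<n. x i = y i"
  then show "a *\<^sub>R A x + b *\<^sub>R B x = a *\<^sub>R A y + b *\<^sub>R B y"
    using sym_nlinear_cong[OF A, of x y] sym_nlinear_cong[OF B, of x y] by simp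
next
  fix x :: "nat \<Rightarrow> 'a" and i assume "i < n"
  then show "linear (\<lambda>v. a *\<^sub>R A (x(i := v)) + b *\<^sub>R B (x(i := v)))"
    by (intro linear_compose_add linear_compose_scale_right sym_nlinear_linear[OF A] sym_nlinear_linear[OF B])
next
  fix x and \<sigma> :: "nat \<Rightarrow> nat" assume "\<sigma> permutes {..<n}"
  then show "a *\<^sub>R A (x \<circ> \<sigma>) + b *\<^sub>R B (x \<circ> \<sigma>) = a *\<^sub>R A x + b *\<^sub>R B x"
    by (simp add: sym_nlinear_permute[OF A] sym_nlinear_permute[OF B])
next
  obtain C D where C: "\<And>x. norm (A x) \<le> C * (\<Prod>i<n. norm (x i))" and D: "\<And>x. norm (B x) \<le> D * (\<Prod>i<n. norm (x i))"
    using sym_nlinear_bound[OF A] sym_nlinear_bound[OF B] by blast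
  have "norm (a *\<^sub>R A x + b *\<^sub>R B x) \<le> (\<bar>a\<bar> * C + \<bar>b\<bar> * D) * (\<Prod>i<n. norm (x i))" for x
  proof -
    have "norm (a *\<^sub>R A x + b *\<^sub>R B x) \<le> \<bar>a\<bar> * norm (A x) + \<bar>b\<bar> * norm (B x)"
      by (rule norm_triangle_le) simp
    also have "\<dots> \<le> \<bar>a\<bar> * (C * (\<Prod>i<n. norm (x i))) + \<bar>b\<bar> * (D * (\<Prod>i<n. norm (x i)))"
      by (intro add_mono mult_left_mono C D) auto
    finally show ?thesis by (simp add: algebra_simps)
  qed
  then show "\<exists>C. \<forall>x. norm (a *\<^sub>R A x + b *\<^sub>R B x) \<le> C * (\<Prod>i<n. norm (x i))" by blast
qed

lemma transfer_form_lincomb: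
  assumes T: "bounded_linear T" and A: "sym_nlinear n A" and B: "sym_nlinear n B"
  shows "transfer_form T n (\<lambda>x. a *\<^sub>R A x + b *\<^sub>R B x) y = a *\<^sub>R transfer_form T n A y + b *\<^sub>R transfer_form T n B y"
proof (rule blinfun_eqI)
  have linT: "linear T" using T by (rule bounded_linear.linear)
  have *: "mixed_seq T (\<lambda>x. a *\<^sub>R A x + b *\<^sub>R B x) k y x g = a * mixed_seq T A k y x g + b * mixed_seq T B k y x g"
    if "k \<le> n" for k y x g
    using that
  proof (induction k arbitrary: y x)
    case 0
    then show ?case by (simp add: blinfun.bilinear_simps)
  next
    case (Suc k)
    have bl: "bounded_linear (\<lambda>v. mixed_seq T A k y (x(k := v)) g)" "bounded_linear (\<lambda>v. mixed_seq T B k y (x(k := v)) g)"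
      using Suc.prems by (auto intro!: mixed_slot_bounded_linear mixed_mixed_seq T A B)
    show ?case
      using Suc by (simp add: mixed_step_def lift_slot_lincomb[OF linT bl])
  qed
  fix g
  show "blinfun_apply (transfer_form T n (\<lambda>x. a *\<^sub>R A x + b *\<^sub>R B x) y) g
      = blinfun_apply (a *\<^sub>R transfer_form T n A y + b *\<^sub>R transfer_form T n B y) g"
    using *[of n y "\<lambda>_. 0" g]
    by (simp add: transfer_form_apply[OF T sym_nlinear_lincomb[OF A B], where x = "\<lambda>_. 0"]
        transfer_form_apply[OF T A, where x = "\<lambda>_. 0"] transfer_form_apply[OF T B, where x = "\<lambda>_. 0"]
        blinfun.bilinear_simps)
qed

section \<open>Polarization and regular polynomials\<close>

text \<open>The product rule for a multilinear map, prepared for polarization. Expanding slot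
  \<open>m\<close> splits off a multiple of \<open>t\<close>, and at 0 only the value of the other
  factor contributes to its derivative.\<close>

lemma sym_nlinear_has_vector_derivative:
  assumes A: "sym_nlinear n A"
  shows "m \<le> n \<Longrightarrow> ((\<lambda>t. A (\<lambda>i. if i < m then c i + t *\<^sub>R y else c i))
    has_vector_derivative (\<Sum>j<m. A (c(j := y)))) (at 0)"
proof (induction m arbitrary: c)
  case 0
  then show ?case by simp
next
  case (Suc m)
  let ?G = "\<lambda>c t. A (\<lambda>i. if i < m then c i + t *\<^sub>R y else c i)"
  have lin: "linear (\<lambda>v. A (z(m := v)))" for z
    by (rule sym_nlinear_linear[OF A]) (use Suc.prems in simp)
  have eq: "A (\<lambda>i. if i < Suc m then c i + t *\<^sub>R y else c i) = ?G c t + t *\<^sub>R ?G (c(m := y)) t" for t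
  proof -
    let ?z = "\<lambda>i. if i < m then c i + t *\<^sub>R y else c i"
    have 1: "(\<lambda>i. if i < Suc m then c i + t *\<^sub>R y else c i) = ?z(m := c m + t *\<^sub>R y)"
      "(\<lambda>i. if i < m then (c(m := y)) i + t *\<^sub>R y else (c(m := y)) i) = ?z(m := y)"
      "?z(m := c m) = ?z"
      by (auto simp: fun_eq_iff less_Suc_eq)
    have "A (?z(m := c m + t *\<^sub>R y)) = A (?z(m := c m)) + t *\<^sub>R A (?z(m := y))"
      by (simp only: linear_add[OF lin] linear_scale[OF lin])
    then show ?thesis by (simp only: 1)
  qed
  have "((\<lambda>t. ?G c t + t *\<^sub>R ?G (c(m := y)) t) has_vector_derivative
      (\<Sum>j<m. A (c(j := y))) + (0 *\<^sub>R (\<Sum>j<m. A ((c(m := y))(j := y))) + 1 *\<^sub>R ?G (c(m := y)) 0)) (at 0)"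
    by (intro has_vector_derivative_add has_vector_derivative_scaleR Suc.IH DERIV_ident)
       (use Suc.prems in auto)
  moreover have "?G (c(m := y)) 0 = A (c(m := y))"
    by (rule arg_cong[of _ _ A]) auto
  ultimately show ?case
    unfolding eq by (simp del: fun_upd_apply)
qed

text \<open>Downward induction on the number of equal leading entries. If \<open>A\<close> vanishes
  whenever \<open>k + 1\<close> leading entries agree, differentiating in the direction
  \<open>w k\<close> shows that a sum of \<open>k + 1\<close> terms is 0. By symmetry they coincide,
  and each is \<open>A\<close> at a tuple with \<open>k\<close> equal leading entries.\<close>

lemma sym_nlinear_polarization:
  fixes A :: "(nat \<Rightarrow> 'e::banach_lattice) \<Rightarrow> ('g::banach_lattice \<Rightarrow>\<^sub>L real)"
  assumes A: "sym_nlinear n A" and diag: "\<And>x. A (\<lambda>_. x) = 0"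
  shows "A z = 0"
proof -
  have "A (\<lambda>i. if i < k then x else w i) = 0" if "k \<le> n" for k x w
    using that
  proof (induction k arbitrary: x w rule: inc_induct)
    case base
    have "A (\<lambda>i. if i < n then x else w i) = A (\<lambda>_. x)" by (rule sym_nlinear_cong[OF A]) simp
    then show ?case using diag by simp
  next
    case (step k)
    define c where "c i = (if i < Suc k then x else w i)" for i
    have "((\<lambda>t. A (\<lambda>i. if i < Suc k then c i + t *\<^sub>R w k else c i))
        has_vector_derivative (\<Sum>j<Suc k. A (c(j := w k)))) (at 0)"
      by (rule sym_nlinear_has_vector_derivative[OF A]) (use step in simp)
    moreover have "A (\<lambda>i. if i < Suc k then c i + t *\<^sub>R w k else c i) = 0" for t
    proof -
      have "(\<lambda>i. if i < Suc k then c i + t *\<^sub>R w k else c i) = (\<lambda>i. if i < Suc k then x + t *\<^sub>R w k else w i)"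
        by (auto simp: c_def)
      then show ?thesis using step.IH by simp
    qed
    ultimately have sum0: "(\<Sum>j<Suc k. A (c(j := w k))) = 0"
      using vector_derivative_unique_at[OF _ has_vector_derivative_const[of 0 "at 0"]] by simp
    have same: "A (c(j := w k)) = A (c(k := w k))" if "j < Suc k" for j
    proof -
      have "c(j := w k) = c(k := w k) \<circ> Transposition.transpose j k"
        using that by (auto simp: fun_eq_iff Transposition.transpose_def c_def)
      moreover have "Transposition.transpose j k permutes {..<n}"
        by (rule permutes_swap_id) (use that step in auto)
      ultimately show ?thesis
        using sym_nlinear_permute[OF A, of _ "c(k := w k)"] by metis
    qed
    have "(\<Sum>j<Suc k. A (c(j := w k))) = (\<Sum>j<Suc k. A (c(k := w k)))"
      by (rule sum.cong[OF refl], rule same) (simp only: lessThan_iff)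
    then have "real (Suc k) *\<^sub>R A (c(k := w k)) = 0"
      unfolding sum0 sum_constant_scaleR card_lessThan by (rule sym)
    moreover have "c(k := w k) = (\<lambda>i. if i < k then x else w i)"
      by (auto simp: c_def fun_eq_iff)
    ultimately show ?case by simp
  qed
  from this[of 0 _ z] show ?thesis by simp
qed

lemma sym_nlinear_diff:
  "sym_nlinear n A \<Longrightarrow> sym_nlinear n B \<Longrightarrow> sym_nlinear n (\<lambda>x. A x - B x)"
  using sym_nlinear_lincomb[of n A B 1 "-1"] by simp

lemma sym_nlinear_diag_inject:
  assumes "sym_nlinear n A" "sym_nlinear n B" "\<And>x. A (\<lambda>_. x) = B (\<lambda>_. x)"
  shows "A = B"
proof
  show "A z = B z" for z
    using sym_nlinear_polarization[OF sym_nlinear_diff[OF assms(1,2)], of z] assms(3) by simp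
qed

section \<open>Regular forms and the polynomials they define\<close>

lemma positive_form_lincomb:
  assumes "positive_form n A" "positive_form n B" "0 \<le> a" "0 \<le> b"
  shows "positive_form n (\<lambda>x. a *\<^sub>R A x + b *\<^sub>R B x)"
  using assms by (auto simp: positive_form_def dle_def blinfun.bilinear_simps intro: sym_nlinear_lincomb)

definition regular_form :: "nat \<Rightarrow> ((nat \<Rightarrow> 'e::banach_lattice) \<Rightarrow> ('g::banach_lattice \<Rightarrow>\<^sub>L real)) \<Rightarrow> bool" where
  "regular_form n A \<longleftrightarrow> (\<exists>A1 A2. positive_form n A1 \<and> positive_form n A2 \<and> A = (\<lambda>x. A1 x - A2 x))"

lemma regular_form_sym_nlinear: "regular_form n A \<Longrightarrow> sym_nlinear n A"
  by (auto simp: regular_form_def positive_form_def intro: sym_nlinear_diff)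

lemma regular_form_lincomb:
  assumes "regular_form n A" "regular_form n B"
  shows "regular_form n (\<lambda>x. a *\<^sub>R A x + b *\<^sub>R B x)"
proof -
  obtain A1 A2 where A: "positive_form n A1" "positive_form n A2" "A = (\<lambda>x. A1 x - A2 x)"
    using assms by (auto simp: regular_form_def)
  obtain B1 B2 where B: "positive_form n B1" "positive_form n B2" "B = (\<lambda>x. B1 x - B2 x)"
    using assms by (auto simp: regular_form_def)
  \<comment> \<open>A negative coefficient exchanges the roles of the two positive forms, so each
    coefficient is split into positive and negative part.\<close>
  define p q where "p = (\<lambda>c :: real. max c 0)" and "q = (\<lambda>c :: real. max (- c) 0)"
  have pq: "c = p c - q c" "0 \<le> p c" "0 \<le> q c" for c by (auto simp: p_def q_def)
  let ?P = "\<lambda>x. 1 *\<^sub>R (p a *\<^sub>R A1 x + q a *\<^sub>R A2 x) + 1 *\<^sub>R (p b *\<^sub>R B1 x + q b *\<^sub>R B2 x)"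
  let ?Q = "\<lambda>x. 1 *\<^sub>R (p a *\<^sub>R A2 x + q a *\<^sub>R A1 x) + 1 *\<^sub>R (p b *\<^sub>R B2 x + q b *\<^sub>R B1 x)"
  have "positive_form n ?P" "positive_form n ?Q"
    by (intro positive_form_lincomb A B pq; simp)+
  moreover have "a *\<^sub>R A x + b *\<^sub>R B x = ?P x - ?Q x" for x
    by (subst pq(1)[of a], subst pq(1)[of b]) (simp add: A(3) B(3) algebra_simps)
  ultimately show ?thesis unfolding regular_form_def by blast
qed

lemma pos_poly_iff: "pos_poly n P \<longleftrightarrow> (\<exists>A. positive_form n A \<and> P = (\<lambda>x. A (\<lambda>_. x)))"
  unfolding pos_poly_def positive_form_def by blast

lemma reg_poly_iff: "P \<in> reg_poly n \<longleftrightarrow> (\<exists>A. regular_form n A \<and> P = (\<lambda>x. A (\<lambda>_. x)))"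
proof
  assume "P \<in> reg_poly n"
  then obtain A1 A2 where "positive_form n A1" "positive_form n A2" "P = (\<lambda>x. A1 (\<lambda>_. x) - A2 (\<lambda>_. x))"
    by (auto simp: reg_poly_def pos_poly_iff)
  then show "\<exists>A. regular_form n A \<and> P = (\<lambda>x. A (\<lambda>_. x))"
    by (intro exI[of _ "\<lambda>x. A1 x - A2 x"]) (auto simp: regular_form_def)
next
  assume "\<exists>A. regular_form n A \<and> P = (\<lambda>x. A (\<lambda>_. x))"
  then show "P \<in> reg_poly n"
    unfolding regular_form_def reg_poly_def pos_poly_iff by auto
qed

text \<open>Polarization identifies the positive form behind the difference of the polynomials with
  the difference of their forms.\<close>

lemma ple_diag_iff:
  assumes "regular_form n A" "regular_form n B"
  shows "ple n (\<lambda>x. A (\<lambda>_. x)) (\<lambda>x. B (\<lambda>_. x)) \<longleftrightarrow> positive_form n (\<lambda>x. B x - A x)"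
proof
  assume "ple n (\<lambda>x. A (\<lambda>_. x)) (\<lambda>x. B (\<lambda>_. x))"
  then obtain C where C: "positive_form n C" "(\<lambda>x. B (\<lambda>_. x) - A (\<lambda>_. x)) = (\<lambda>x. C (\<lambda>_. x))"
    by (auto simp: ple_def pos_poly_iff)
  have "C = (\<lambda>x. B x - A x)"
  proof (rule sym_nlinear_diag_inject)
    show "sym_nlinear n C" using C by (simp add: positive_form_def)
    show "sym_nlinear n (\<lambda>x. B x - A x)" using assms by (intro sym_nlinear_diff regular_form_sym_nlinear)
    show "C (\<lambda>_. x) = B (\<lambda>_. x) - A (\<lambda>_. x)" for x using C(2) by (metis (no_types))
  qed
  then show "positive_form n (\<lambda>x. B x - A x)" using C by simp
qed (auto simp: ple_def pos_poly_iff)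

lemma transfer_form_diff:
  assumes "bounded_linear T" "sym_nlinear n A" "sym_nlinear n B"
  shows "transfer_form T n (\<lambda>x. A x - B x) = (\<lambda>y. transfer_form T n A y - transfer_form T n B y)"
  using transfer_form_lincomb[OF assms, of 1 "-1"] by (simp add: fun_eq_iff)

text \<open>The choice is harmless: by polarization a regular polynomial comes from a single regular
  form.\<close>

definition transfer_poly ::
  "(('e::banach_lattice \<Rightarrow>\<^sub>L real) \<Rightarrow> ('f::banach_lattice \<Rightarrow>\<^sub>L real)) \<Rightarrow> nat \<Rightarrow>
    ('e \<Rightarrow> ('g::banach_lattice \<Rightarrow>\<^sub>L real)) \<Rightarrow> 'f \<Rightarrow> ('g \<Rightarrow>\<^sub>L real)" where
  "transfer_poly T n P = (\<lambda>y. transfer_form T n (SOME A. regular_form n A \<and> P = (\<lambda>x. A (\<lambda>_. x))) (\<lambda>_. y))"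

lemma transfer_poly_diag:
  assumes "regular_form n A"
  shows "transfer_poly T n (\<lambda>x. A (\<lambda>_. x)) = (\<lambda>y. transfer_form T n A (\<lambda>_. y))"
proof -
  have "(SOME B. regular_form n B \<and> (\<lambda>x. A (\<lambda>_. x)) = (\<lambda>x. B (\<lambda>_. x))) = A"
  proof (rule some_equality)
    fix B assume B: "regular_form n B \<and> (\<lambda>x. A (\<lambda>_. x)) = (\<lambda>x. B (\<lambda>_. x))"
    show "B = A"
    proof (rule sym_nlinear_diag_inject)
      show "sym_nlinear n B" "sym_nlinear n A" using B assms by (auto intro: regular_form_sym_nlinear)
      show "B (\<lambda>_. x) = A (\<lambda>_. x)" for x using B by (metis (no_types))
    qed
  qed (use assms in simp)
  then show ?thesis by (simp add: transfer_poly_def)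
qed

locale dual_lattice_operator =
  fixes T :: "('e::banach_lattice \<Rightarrow>\<^sub>L real) \<Rightarrow> ('f::banach_lattice \<Rightarrow>\<^sub>L real)"
  assumes bounded: "bounded_linear T" and positive: "dle 0 f \<Longrightarrow> dle 0 (T f)"
    and order_continuous: "order_continuous_norm TYPE('e dual)"
begin

lemma regular_form_transfer:
  assumes "regular_form n A"
  shows "regular_form n (transfer_form T n A)"
proof -
  obtain A1 A2 where A: "positive_form n A1" "positive_form n A2" "A = (\<lambda>x. A1 x - A2 x)"
    using assms by (auto simp: regular_form_def)
  have "transfer_form T n A = (\<lambda>y. transfer_form T n A1 y - transfer_form T n A2 y)"
    unfolding A(3) using A(1,2) by (intro transfer_form_diff bounded) (auto simp: positive_form_def)
  moreover have "positive_form n (transfer_form T n A1)" "positive_form n (transfer_form T n A2)"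
    by (rule positive_form_transfer[OF bounded positive order_continuous], assumption, rule A)+
  ultimately show ?thesis unfolding regular_form_def by blast
qed

lemma transfer_poly_reg_poly:
  assumes "P \<in> reg_poly n"
  shows "transfer_poly T n P \<in> reg_poly n"
proof -
  obtain A where A: "regular_form n A" "P = (\<lambda>x. A (\<lambda>_. x))" using assms by (auto simp: reg_poly_iff)
  then show ?thesis
    using regular_form_transfer[OF A(1)] by (auto simp: reg_poly_iff transfer_poly_diag)
qed

lemma transfer_poly_lincomb:
  assumes "P \<in> reg_poly n" "Q \<in> reg_poly n"
  shows "transfer_poly T n (\<lambda>x. a *\<^sub>R P x + b *\<^sub>R Q x)
    = (\<lambda>y. a *\<^sub>R transfer_poly T n P y + b *\<^sub>R transfer_poly T n Q y)"
proof -
  obtain A where A: "regular_form n A" "P = (\<lambda>x. A (\<lambda>_. x))" using assms by (auto simp: reg_poly_iff)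
  obtain B where B: "regular_form n B" "Q = (\<lambda>x. B (\<lambda>_. x))" using assms by (auto simp: reg_poly_iff)
  show ?thesis
    using transfer_poly_diag[OF regular_form_lincomb[OF A(1) B(1)], of T a b]
    by (simp add: A(2) B(2) transfer_poly_diag A(1) B(1)
        transfer_form_lincomb[OF bounded regular_form_sym_nlinear[OF A(1)] regular_form_sym_nlinear[OF B(1)]])
qed

lemma transfer_poly_mono:
  assumes "P \<in> reg_poly n" "Q \<in> reg_poly n" "ple n P Q"
  shows "ple n (transfer_poly T n P) (transfer_poly T n Q)"
proof -
  obtain A where A: "regular_form n A" "P = (\<lambda>x. A (\<lambda>_. x))" using assms by (auto simp: reg_poly_iff)
  obtain B where B: "regular_form n B" "Q = (\<lambda>x. B (\<lambda>_. x))" using assms by (auto simp: reg_poly_iff)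
  have "positive_form n (\<lambda>x. B x - A x)"
    using assms(3) unfolding A(2) B(2) ple_diag_iff[OF A(1) B(1)] .
  then have "positive_form n (transfer_form T n (\<lambda>x. B x - A x))"
    by (intro positive_form_transfer bounded positive order_continuous)
  then have "positive_form n (\<lambda>y. transfer_form T n B y - transfer_form T n A y)"
    by (simp only: transfer_form_diff[OF bounded regular_form_sym_nlinear[OF B(1)] regular_form_sym_nlinear[OF A(1)]])
  then show ?thesis
    unfolding A(2) B(2) transfer_poly_diag[OF A(1)] transfer_poly_diag[OF B(1)]
      ple_diag_iff[OF regular_form_transfer[OF A(1)] regular_form_transfer[OF B(1)]] .
qed

lemma transfer_poly_inverse:
  assumes S: "bounded_linear S" "\<And>f. S (T f) = f" and P: "P \<in> reg_poly n"
  shows "transfer_poly S n (transfer_poly T n P) = P"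
proof -
  obtain A where A: "regular_form n A" "P = (\<lambda>x. A (\<lambda>_. x))" using P by (auto simp: reg_poly_iff)
  have "transfer_form S n (transfer_form T n A) = A"
    by (intro transfer_form_inverse bounded S regular_form_sym_nlinear regular_form_transfer A)
  then show ?thesis
    by (simp add: A(2) transfer_poly_diag[OF A(1)] transfer_poly_diag[OF regular_form_transfer[OF A(1)]])
qed

end

theorem theorem2p5:
  assumes "duals_lattice_isomorphic TYPE('e::banach_lattice) TYPE('f::banach_lattice)"
    and "dual_order_continuous TYPE('e) \<or> dual_order_continuous TYPE('f)"
  shows "\<forall>n::nat. reg_polys_lattice_isomorphic n TYPE('e) TYPE('f) TYPE('g::banach_lattice)"
proof
  fix n :: nat
  obtain T :: "('e \<Rightarrow>\<^sub>L real) \<Rightarrow> ('f \<Rightarrow>\<^sub>L real)" where T: "bij T" "linear T" "\<And>f g. dle f g \<longleftrightarrow> dle (T f) (T g)"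
    using assms(1) unfolding duals_lattice_isomorphic_def by blast
  define S where "S = inv T"
  have ST: "S (T f) = f" and TS: "T (S g) = g" for f g
    using T(1) by (simp_all add: S_def bij_is_inj bij_is_surj surj_f_inv_f)
  have S: "bij S" "linear S" "\<And>f g. dle f g \<longleftrightarrow> dle (S f) (S g)"
  proof -
    show "bij S" unfolding S_def using T(1) by (rule bij_imp_bij_inv)
    show "linear S"
      by (rule linearI) (metis ST TS linear_add[OF T(2)], metis ST TS linear_scale[OF T(2)])
    show "dle f g \<longleftrightarrow> dle (S f) (S g)" for f g
      using T(3)[of "S f" "S g"] by (simp add: TS)
  qed
  have oc: "dual_order_continuous TYPE('e)" "dual_order_continuous TYPE('f)"
    using assms(2) dual_order_continuous_transport[OF T(2,1,3)] dual_order_continuous_transport[OF S(2,1,3)]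
    by blast+
  have posT: "dle 0 (T f)" if "dle 0 f" for f
    using that T(3)[of 0 f] by (simp add: linear_0[OF T(2)])
  have posS: "dle 0 (S f)" if "dle 0 f" for f
    using that S(3)[of 0 f] by (simp add: linear_0[OF S(2)])
  interpret T: dual_lattice_operator T
    by (intro dual_lattice_operator.intro positive_blinfun_operator_bounded T(2) posT
        order_continuous_norm_dual oc)
  interpret S: dual_lattice_operator S
    by (intro dual_lattice_operator.intro positive_blinfun_operator_bounded S(2) posS
        order_continuous_norm_dual oc)
  let ?T = "transfer_poly T n :: ('e \<Rightarrow> ('g \<Rightarrow>\<^sub>L real)) \<Rightarrow> _"
  let ?S = "transfer_poly S n :: ('f \<Rightarrow> ('g \<Rightarrow>\<^sub>L real)) \<Rightarrow> _"
  have inv: "?S (?T P) = P" if "P \<in> reg_poly n" for P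
    by (rule T.transfer_poly_inverse[OF S.bounded ST that])
  have inv': "?T (?S P) = P" if "P \<in> reg_poly n" for P
    by (rule S.transfer_poly_inverse[OF T.bounded TS that])
  show "reg_polys_lattice_isomorphic n TYPE('e) TYPE('f) TYPE('g)"
    unfolding reg_polys_lattice_isomorphic_def
  proof (intro exI[of _ ?T] conjI ballI allI)
    show "bij_betw ?T (reg_poly n) (reg_poly n)"
      by (rule bij_betw_byWitness[where f' = ?S])
         (auto simp: inv inv' T.transfer_poly_reg_poly S.transfer_poly_reg_poly)
    show "?T (\<lambda>x. a *\<^sub>R P x + b *\<^sub>R Q x) = (\<lambda>y. a *\<^sub>R ?T P y + b *\<^sub>R ?T Q y)"
      if "P \<in> reg_poly n" "Q \<in> reg_poly n" for P Q a b
      using that by (rule T.transfer_poly_lincomb)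
    show "ple n P Q \<longleftrightarrow> ple n (?T P) (?T Q)" if PQ: "P \<in> reg_poly n" "Q \<in> reg_poly n" for P Q
    proof
      show "ple n (?T P) (?T Q)" if "ple n P Q" by (rule T.transfer_poly_mono[OF PQ that])
      show "ple n P Q" if "ple n (?T P) (?T Q)"
        using S.transfer_poly_mono[OF T.transfer_poly_reg_poly[OF PQ(1)] T.transfer_poly_reg_poly[OF PQ(2)] that]
        by (simp add: inv PQ)
    qed
  qed
qed

end
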